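(* Let $n,m,l,d_*,d$ be integers with $n\ge 0$, $m\ge 0$, $l\ge 1$, $0\le d_*\le m$, $d_*\le d\le d_*+l$, and let $\omega\in\mathbb R^n$ be any vector. **Part A (non-compact phase space).** Let $\mathcal K=\mathbb R^m_u\times\mathbb T^n_\varphi\times\mathbb R^l_q$ with the involution $G:(u,\varphi,q)\mapsto(u,-\varphi,-q)$ of type $(n+l,m)$. There exists a system of ordinary differential equations on $\mathcal K$, reversible with respect to $G$, with the following properties. (i) The right-hand side of the system is independent of $\varphi$ and polynomial in $(u,q)$. (ii) The system admits a $d$-parameter analytic family of Kronecker $n$-tori of the form $\{u=\mathrm{const},\ q=\mathrm{const}\}$. (iii) There are no Kronecker tori (of any dimension) outside this family, i.e., no point of $\mathcal K$ outside the union of the tori of the family belongs to a Kronecker torus of any dimension. (iv) The family includes a $d_*$-parameter analytic subfamily of symmetric Kronecker $n$-tori of the form $\{u=\mathrm{const},\ q=0\}$. (v) The $n$-torus $\{u=0,\ q=0\}$ belongs to this subfamily and its frequency vector is equal to $\omega$. (vi) If $d_*=d=0$ then the torus $\{u=0,\ q=0\}$ is unique. (vii) If $d_*=m$ and $d=m+l$ then the $d$-parameter family makes up the whole phase space $\mathcal K$. **Part B (compact phase space).** Let $\widehat{\mathcal K}=\mathbb T^m_u\times\mathbb T^n_\varphi\times\mathbb T^l_q$ with the involution $G:(u,\varphi,q)\mapsto(u,-\varphi,-q)$ of type $(n+l,m)$. There exists a system of ordinary differential equations on $\widehat{\mathcal K}$, reversible with respect to $G$, with the following properties. (i) The right-hand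 side of the system is independent of $\varphi$ and trigonometric polynomial in $(u,q)$. (ii) The system admits a $d$-parameter analytic family of Kronecker $n$-tori of the form $\{u=\mathrm{const},\ q=\mathrm{const}\}$. (iii) The family includes a $d_*$-parameter analytic subfamily of symmetric Kronecker $n$-tori of the form $\{u=\mathrm{const},\ q=q^0\}$, where each component of $q^0$ is equal to either $0$ or $\pi$. (iv) The $n$-torus $\{u=0,\ q=0\}$ belongs to this subfamily and its frequency vector is equal to $\omega$. (v) If $d_*=d=0$ then the torus $\{u=0,\ q=0\}$ is strongly isolated. (vi) If $d_*=m$ and $d=m+l$ then the $d$-parameter family makes up the whole phase space $\widehat{\mathcal K}$. (In Part B it is not asserted that there are no Kronecker tori outside the family.)
   Context: **Notation.** $\mathbb T^a=(\mathbb R/2\pi\mathbb Z)^a$. $\mathbb R^a_w$ denotes $\mathbb R^a$ with coordinates $w=(w_1,\dots,w_a)$, and $\mathbb T^a_\varphi$ denotes $\mathbb T^a$ with angular coordinates $\varphi=(\varphi_1,\dots,\varphi_a)$ (similarly for other letters); for $a=0$ these are single points. **Kronecker tori.** Given a flow on a manifold (in general, the local flow of a system of ordinary differential equations), a Kronecker $n$-torus ($n\ge 0$ an integer), i.e., an invariant $n$-torus carrying conditionally periodic motions, is an invariant submanifold $\mathcal T$ diffeomorphic to $\mathbb T^n$ such that in a suitable angular coordinate $\varphi\in\mathbb T^n$ on $\mathcal T$ the induced dynamics is $\dot\varphi=\omega$ with a constant vector $\omega\in\mathbb R^n$, called the frequency vector. No non-resonance condition is imposed on $\omega$; a Kronecker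 $0$-torus is an equilibrium. For tori of the form $\{u=\mathrm{const},\ q=\mathrm{const}\}$ the frequency vector is taken with respect to the coordinate $\varphi$. **Families.** A $d$-parameter analytic family of tori of the form $\{u=\mathrm{const},\ q=\mathrm{const}\}$ is a collection $\{u=u^0,\ q=q^0\}$, $(u^0,q^0)\in S$, where $S$ is a (not necessarily connected) $d$-dimensional real-analytic submanifold of the $(u,q)$-space; a $d_*$-parameter analytic subfamily is obtained from a $d_*$-dimensional real-analytic submanifold $S_*\subset S$ (not necessarily connected, so that in the compact case $q^0$ may differ from torus to torus). The family makes up the whole phase space if $S$ is the whole $(u,q)$-space. **Reversibility.** A system $\dot x=X(x)$ is reversible with respect to an involution $G$ of the phase space ($G\circ G=\mathrm{id}$) if $G$ maps the vector field $X$ to $-X$, i.e., $DG(x)X(x)=-X(G(x))$ for all $x$. $G$ is of type $(L,m)$ if its fixed point set $\mathrm{Fix}\,G$ is non-empty, all its connected components have the same dimension, $\dim\mathrm{Fix}\,G=m$ and $\mathrm{codim}\,\mathrm{Fix}\,G=L$. An invariant torus $\mathcal T$ is symmetric if $G(\mathcal T)=\mathcal T$. **Isolatedness.** A Kronecker torus $\mathcal T$ of a dynamical system is strongly isolated if there is a neighborhood $\mathcal O$ of $\mathcal T$ in the phase space such that there are no Kronecker tori (symmetric or not, of any dimension) entirely contained in $\mathcal O\setminus\mathcal T$. It is unique if there are no Kronecker tori (symmetric or not, of any dimension) outside $\mathcal T$ in the whole phase space (i.e., one can take $\mathcal O$ to be the whole phase space). *)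

theory Defs
  imports "HOL-Analysis.Analysis"
begin

section \<open>Products of lines and circles\<close>

text \<open>
  All manifolds occurring here are products of lines and circles.  For a finite index set
  \<open>I\<close> and a set \<open>A \<subseteq> I\<close> of angular coordinates, \<open>cyl I A\<close> is the quotient of \<open>\<real>\<^sup>I\<close> by
  \<open>(2\<pi>\<int>)\<^sup>A\<close>, i.e. the product of one copy of \<open>\<real>\<close> for each index in \<open>I - A\<close> and one
  copy of \<open>\<real>/2\<pi>\<int>\<close> for each index in \<open>A\<close>; its points are cosets.
  As for \<^const>\<open>Euclidean_space\<close>, \<open>\<real>\<^sup>I\<close> consists of the functions vanishing outside \<open>I\<close>.
\<close>

definition RR :: "'i set \<Rightarrow> ('i \<Rightarrow> real) set" where
  "RR I = {x. \<forall>i. i \<notin> I \<longrightarrow> x i = 0}"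

definition cls :: "'i set \<Rightarrow> ('i \<Rightarrow> real) \<Rightarrow> ('i \<Rightarrow> real) set" where
  "cls A x = {y. (\<forall>i\<in>A. \<exists>k::int. y i = x i + 2 * pi * of_int k) \<and> (\<forall>i. i \<notin> A \<longrightarrow> y i = x i)}"

definition cyl :: "'i set \<Rightarrow> 'i set \<Rightarrow> ('i \<Rightarrow> real) set set" where
  "cyl I A = cls A ` RR I"

abbreviation torus :: "nat \<Rightarrow> (nat \<Rightarrow> real) set set" where
  "torus k \<equiv> cyl {..<k} {..<k}"

definition open_RR :: "'i set \<Rightarrow> ('i \<Rightarrow> real) set \<Rightarrow> bool" where
  "open_RR I V \<longleftrightarrow> openin (top_of_set (RR I)) V"

text \<open>The quotient topology:\<close>

definition open_cyl :: "'i set \<Rightarrow> 'i set \<Rightarrow> ('i \<Rightarrow> real) set set \<Rightarrow> bool" where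
  "open_cyl I A W \<longleftrightarrow> W \<subseteq> cyl I A \<and> open_RR I {x \<in> RR I. cls A x \<in> W}"


section \<open>Smooth and real-analytic functions and maps\<close>

text \<open>
  Both notions are meant for sets \<open>V\<close> that are open in \<open>\<real>\<^sup>I\<close>.  In the first one,
  \<open>D [i\<^sub>1, \<dots>, i\<^sub>r]\<close> is the iterated partial derivative of \<open>f\<close> with respect to the
  coordinates \<open>i\<^sub>r, \<dots>, i\<^sub>1\<close>; so \<open>f\<close> is infinitely differentiable.
\<close>

definition smooth_fun :: "'i set \<Rightarrow> ('i \<Rightarrow> real) set \<Rightarrow> (('i \<Rightarrow> real) \<Rightarrow> real) \<Rightarrow> bool" where
  "smooth_fun I V f \<longleftrightarrow>
     (\<exists>D :: 'i list \<Rightarrow> ('i \<Rightarrow> real) \<Rightarrow> real.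
        (\<forall>x\<in>V. D [] x = f x) \<and>
        (\<forall>is\<in>lists I. continuous_on V (D is) \<and>
           (\<forall>i\<in>I. \<forall>x\<in>V. ((\<lambda>t. D is (x(i := t))) has_real_derivative D (i # is) x) (at (x i)))))"

definition analytic_fun :: "'i set \<Rightarrow> ('i \<Rightarrow> real) set \<Rightarrow> (('i \<Rightarrow> real) \<Rightarrow> real) \<Rightarrow> bool" where
  "analytic_fun I V f \<longleftrightarrow>
     (\<forall>a\<in>V. \<exists>r>0. \<exists>c :: ('i \<Rightarrow> nat) \<Rightarrow> real. \<forall>x\<in>V. (\<forall>i\<in>I. \<bar>x i - a i\<bar> < r) \<longrightarrow>
        ((\<lambda>\<alpha>. c \<alpha> * (\<Prod>i\<in>I. (x i - a i) ^ \<alpha> i)) has_sum f x) {\<alpha>. \<forall>i. i \<notin> I \<longrightarrow> \<alpha> i = 0})"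

text \<open>
  A map on a subset \<open>S\<close> of a manifold is smooth if it extends, locally around each point of
  \<open>S\<close>, to a smooth map on an open subset of the manifold.  The quotient maps \<open>cls A\<close> are local
  diffeomorphisms, so smoothness is read off from local lifts \<open>F\<close>.
\<close>

definition smooth_map ::
  "'i set \<Rightarrow> 'i set \<Rightarrow> ('i \<Rightarrow> real) set set \<Rightarrow> 'j set \<Rightarrow> 'j set
     \<Rightarrow> (('i \<Rightarrow> real) set \<Rightarrow> ('j \<Rightarrow> real) set) \<Rightarrow> bool" where
  "smooth_map I A S J B f \<longleftrightarrow>
     (\<forall>x\<in>RR I. cls A x \<in> S \<longrightarrow>
        (\<exists>V F. open_RR I V \<and> x \<in> V \<and> F ` V \<subseteq> RR J \<and> (\<forall>j\<in>J. smooth_fun I V (\<lambda>y. F y j)) \<and>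
               (\<forall>y\<in>V. cls A y \<in> S \<longrightarrow> f (cls A y) = cls B (F y))))"

definition diffeomorphism ::
  "'i set \<Rightarrow> 'i set \<Rightarrow> ('i \<Rightarrow> real) set set \<Rightarrow> 'j set \<Rightarrow> 'j set \<Rightarrow> ('j \<Rightarrow> real) set set
     \<Rightarrow> (('i \<Rightarrow> real) set \<Rightarrow> ('j \<Rightarrow> real) set) \<Rightarrow> bool" where
  "diffeomorphism I A S J B T f \<longleftrightarrow>
     bij_betw f S T \<and> smooth_map I A S J B f \<and> smooth_map J B T I A (the_inv_into S f)"

text \<open>
  A subset \<open>S\<close> of \<open>cyl I A\<close> is a \<open>d\<close>-dimensional (embedded, not necessarily connected)
  submanifold if around each of its points there is a chart of \<open>cyl I A\<close> straightening \<open>S\<close> to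
  a coordinate plane of dimension \<open>d\<close>.  Since \<open>cls A\<close> is injective on the open set \<open>V\<close>,
  it identifies \<open>V\<close> with an open subset of \<open>cyl I A\<close>, and \<open>\<psi>\<close> with a chart there.
  The dimension is the same at all points, hence for all connected components.
  The parameter \<open>C\<close> is \<open>smooth_fun\<close> or \<open>analytic_fun\<close>.
\<close>

definition submanifold ::
  "('i set \<Rightarrow> ('i \<Rightarrow> real) set \<Rightarrow> (('i \<Rightarrow> real) \<Rightarrow> real) \<Rightarrow> bool)
     \<Rightarrow> 'i set \<Rightarrow> 'i set \<Rightarrow> nat \<Rightarrow> ('i \<Rightarrow> real) set set \<Rightarrow> bool" where
  "submanifold C I A d S \<longleftrightarrow>
     S \<subseteq> cyl I A \<and>
     (\<forall>x\<in>RR I. cls A x \<in> S \<longrightarrow>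
        (\<exists>V V' \<psi> \<eta> J. open_RR I V \<and> x \<in> V \<and> inj_on (cls A) V \<and> open_RR I V' \<and>
           \<psi> ` V = V' \<and> \<eta> ` V' = V \<and> (\<forall>y\<in>V. \<eta> (\<psi> y) = y) \<and>
           (\<forall>i\<in>I. C I V (\<lambda>y. \<psi> y i)) \<and> (\<forall>i\<in>I. C I V' (\<lambda>z. \<eta> z i)) \<and>
           J \<subseteq> I \<and> card J = d \<and>
           (\<forall>y\<in>V. cls A y \<in> S \<longleftrightarrow> (\<forall>i\<in>I - J. \<psi> y i = 0))))"


section \<open>Vector fields, reversibility and Kronecker tori\<close>

text \<open>
  The tangent spaces of \<open>cyl I A\<close> are identified with \<open>\<real>\<^sup>I\<close>, so a vector field is a map from
  \<open>cyl I A\<close> to \<open>\<real>\<^sup>I\<close>.  The velocity of a curve is computed on a local lift.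
\<close>

definition vector_field :: "'i set \<Rightarrow> 'i set \<Rightarrow> (('i \<Rightarrow> real) set \<Rightarrow> 'i \<Rightarrow> real) \<Rightarrow> bool" where
  "vector_field I A X \<longleftrightarrow> X ` cyl I A \<subseteq> RR I"

definition has_velocity ::
  "'i set \<Rightarrow> (real \<Rightarrow> ('i \<Rightarrow> real) set) \<Rightarrow> ('i \<Rightarrow> real) \<Rightarrow> real \<Rightarrow> bool" where
  "has_velocity A \<gamma> v t \<longleftrightarrow>
     (\<exists>F :: real \<Rightarrow> 'i \<Rightarrow> real. (\<forall>\<^sub>F s in nhds t. \<gamma> s = cls A (F s)) \<and>
        (\<forall>i. ((\<lambda>s. F s i) has_real_derivative v i) (at t)))"

definition solution ::
  "'i set \<Rightarrow> (('i \<Rightarrow> real) set \<Rightarrow> 'i \<Rightarrow> real) \<Rightarrow> (real \<Rightarrow> ('i \<Rightarrow> real) set) \<Rightarrow> bool" where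
  "solution A X \<gamma> \<longleftrightarrow> (\<forall>t. has_velocity A \<gamma> (X (\<gamma> t)) t)"

text \<open>
  \<open>DG(p) v\<close> is the velocity at time 0 of the image under \<open>G\<close> of the curve \<open>p + t v\<close>.
\<close>

definition reversible ::
  "'i set \<Rightarrow> 'i set \<Rightarrow> (('i \<Rightarrow> real) set \<Rightarrow> 'i \<Rightarrow> real)
     \<Rightarrow> (('i \<Rightarrow> real) set \<Rightarrow> ('i \<Rightarrow> real) set) \<Rightarrow> bool" where
  "reversible I A X G \<longleftrightarrow>
     (\<forall>x\<in>RR I. has_velocity A (\<lambda>t. G (cls A (\<lambda>i. x i + t * X (cls A x) i)))
                  (\<lambda>i. - X (G (cls A x)) i) 0)"

definition Fix :: "'i set \<Rightarrow> 'i set \<Rightarrow> (('i \<Rightarrow> real) set \<Rightarrow> ('i \<Rightarrow> real) set) \<Rightarrow> ('i \<Rightarrow> real) set set" where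
  "Fix I A G = {p \<in> cyl I A. G p = p}"

definition involution_of_type ::
  "'i set \<Rightarrow> 'i set \<Rightarrow> (('i \<Rightarrow> real) set \<Rightarrow> ('i \<Rightarrow> real) set) \<Rightarrow> nat \<Rightarrow> nat \<Rightarrow> bool" where
  "involution_of_type I A G L m \<longleftrightarrow>
     G ` cyl I A \<subseteq> cyl I A \<and> (\<forall>p\<in>cyl I A. G (G p) = p) \<and> smooth_map I A (cyl I A) I A G \<and>
     Fix I A G \<noteq> {} \<and> submanifold smooth_fun I A m (Fix I A G) \<and> card I = m + L"

text \<open>
  \<open>h\<close> is the inverse of the angular coordinate on \<open>T\<close>.  The last condition says both that \<open>T\<close> is
  invariant and that the induced dynamics is \<open>\<phi>' = \<omega>\<close>: for the (trigonometric) polynomial fields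
  below, solutions are unique, so \<open>h (\<theta> + t \<omega>)\<close> is the orbit of \<open>h \<theta>\<close> under the flow.
\<close>

definition kronecker_torus_with ::
  "'i set \<Rightarrow> 'i set \<Rightarrow> (('i \<Rightarrow> real) set \<Rightarrow> 'i \<Rightarrow> real) \<Rightarrow> nat \<Rightarrow> ('i \<Rightarrow> real) set set
     \<Rightarrow> ((nat \<Rightarrow> real) set \<Rightarrow> ('i \<Rightarrow> real) set) \<Rightarrow> (nat \<Rightarrow> real) \<Rightarrow> bool" where
  "kronecker_torus_with I A X k T h \<omega> \<longleftrightarrow>
     submanifold smooth_fun I A k T \<and>
     diffeomorphism {..<k} {..<k} (torus k) I A T h \<and>
     \<omega> \<in> RR {..<k} \<and>
     (\<forall>\<theta>\<in>RR {..<k}. solution A X (\<lambda>t. h (cls {..<k} (\<lambda>j. \<theta> j + t * \<omega> j))))"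

definition kronecker_torus ::
  "'i set \<Rightarrow> 'i set \<Rightarrow> (('i \<Rightarrow> real) set \<Rightarrow> 'i \<Rightarrow> real) \<Rightarrow> nat \<Rightarrow> ('i \<Rightarrow> real) set set \<Rightarrow> bool" where
  "kronecker_torus I A X k T \<longleftrightarrow> (\<exists>h \<omega>. kronecker_torus_with I A X k T h \<omega>)"

definition strongly_isolated ::
  "'i set \<Rightarrow> 'i set \<Rightarrow> (('i \<Rightarrow> real) set \<Rightarrow> 'i \<Rightarrow> real) \<Rightarrow> ('i \<Rightarrow> real) set set \<Rightarrow> bool" where
  "strongly_isolated I A X T \<longleftrightarrow>
     (\<exists>W. open_cyl I A W \<and> T \<subseteq> W \<and> \<not> (\<exists>k T'. kronecker_torus I A X k T' \<and> T' \<subseteq> W - T))"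

definition unique_torus ::
  "'i set \<Rightarrow> 'i set \<Rightarrow> (('i \<Rightarrow> real) set \<Rightarrow> 'i \<Rightarrow> real) \<Rightarrow> ('i \<Rightarrow> real) set set \<Rightarrow> bool" where
  "unique_torus I A X T \<longleftrightarrow> \<not> (\<exists>k T'. kronecker_torus I A X k T' \<and> T' \<subseteq> cyl I A - T)"


section \<open>The coordinates \<open>(u, \<phi>, q)\<close>\<close>

datatype coord = Cu nat | Cphi nat | Cq nat

definition uq_coords :: "nat \<Rightarrow> nat \<Rightarrow> coord set" where
  "uq_coords m l = Cu ` {..<m} \<union> Cq ` {..<l}"

definition phi_coords :: "nat \<Rightarrow> coord set" where
  "phi_coords n = Cphi ` {..<n}"

definition all_coords :: "nat \<Rightarrow> nat \<Rightarrow> nat \<Rightarrow> coord set" where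
  "all_coords m n l = uq_coords m l \<union> phi_coords n"

text \<open>The involution \<open>(u, \<phi>, q) \<mapsto> (u, -\<phi>, -q)\<close>, on \<open>\<real>\<^sup>I\<close> and on cosets:\<close>

definition flip :: "(coord \<Rightarrow> real) \<Rightarrow> coord \<Rightarrow> real" where
  "flip x c = (case c of Cu i \<Rightarrow> x c | Cphi i \<Rightarrow> - x c | Cq i \<Rightarrow> - x c)"

definition GG :: "(coord \<Rightarrow> real) set \<Rightarrow> (coord \<Rightarrow> real) set" where
  "GG p = flip ` p"

text \<open>
  Let \<open>J\<close> be the set of \<open>(u, q)\<close>-coordinates and \<open>B = A \<inter> J\<close>.  For a point \<open>s\<close> of the
  \<open>(u, q)\<close>-space \<open>cyl J B\<close>, \<open>fibre I A J B s\<close> is the subset \<open>{(u, q) = s}\<close> of \<open>cyl I A\<close>.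
\<close>

definition fibre ::
  "coord set \<Rightarrow> coord set \<Rightarrow> coord set \<Rightarrow> coord set \<Rightarrow> (coord \<Rightarrow> real) set \<Rightarrow> (coord \<Rightarrow> real) set set" where
  "fibre I A J B s =
     {cls A x | x. x \<in> RR I \<and> cls B (\<lambda>c. if c \<in> J then x c else 0) = s}"

text \<open>
  The parametrization of the torus \<open>{u = 0, q = 0}\<close> by the coordinate \<open>\<phi>\<close>; all members \<open>\<theta>\<close> of
  the coset \<open>\<Theta>\<close> give the same coset of \<open>(0, \<theta>, 0)\<close>.
\<close>

definition phi_param :: "coord set \<Rightarrow> (nat \<Rightarrow> real) set \<Rightarrow> (coord \<Rightarrow> real) set" where
  "phi_param A \<Theta> = (\<Union>\<theta>\<in>\<Theta>. cls A (\<lambda>c. case c of Cphi i \<Rightarrow> \<theta> i | _ \<Rightarrow> 0))"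

text \<open>
  (Trigonometric) polynomials on \<open>\<real>\<^sup>I\<close> in the variables from \<open>J\<close> only, in particular
  independent of the variables from \<open>I - J\<close>.
\<close>

definition polynomial_in :: "'i set \<Rightarrow> 'i set \<Rightarrow> (('i \<Rightarrow> real) \<Rightarrow> real) \<Rightarrow> bool" where
  "polynomial_in I J f \<longleftrightarrow>
     (\<exists>(M :: ('i \<Rightarrow> nat) set) c. finite M \<and>
        (\<forall>x\<in>RR I. f x = (\<Sum>\<alpha>\<in>M. c \<alpha> * (\<Prod>j\<in>J. x j ^ \<alpha> j))))"

definition trig_polynomial_in :: "'i set \<Rightarrow> 'i set \<Rightarrow> (('i \<Rightarrow> real) \<Rightarrow> real) \<Rightarrow> bool" where
  "trig_polynomial_in I J f \<longleftrightarrow>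
     (\<exists>(M :: ('i \<Rightarrow> int) set) a b. finite M \<and>
        (\<forall>x\<in>RR I. f x = (\<Sum>k\<in>M. a k * cos (\<Sum>j\<in>J. of_int (k j) * x j)
                                 + b k * sin (\<Sum>j\<in>J. of_int (k j) * x j))))"

text \<open>A \<open>d\<close>-parameter analytic family of Kronecker \<open>n\<close>-tori \<open>{u = const, q = const}\<close>:\<close>

definition analytic_family ::
  "coord set \<Rightarrow> coord set \<Rightarrow> coord set \<Rightarrow> coord set \<Rightarrow> ((coord \<Rightarrow> real) set \<Rightarrow> coord \<Rightarrow> real)
     \<Rightarrow> nat \<Rightarrow> nat \<Rightarrow> (coord \<Rightarrow> real) set set \<Rightarrow> bool" where
  "analytic_family I A J B X n d S \<longleftrightarrow>
     submanifold analytic_fun J B d S \<and> (\<forall>s\<in>S. kronecker_torus I A X n (fibre I A J B s))"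

end

theory Submission
  imports Defs
begin

text \<open>
  Take the system \<open>u' = 0\<close>, \<open>\<phi>' = \<omega>\<close>, \<open>q\<^sub>j' = 0\<close> for \<open>j < l - 1\<close>, in which \<open>q\<^sub>l\<^sub>-\<^sub>1\<close> moves
  with velocity \<open>\<Sum> g(c)\<close>, the sum being over the coordinates \<open>c\<close> among \<open>u\<^sub>i\<close> with \<open>i \<ge> d\<^sub>*\<close> and \<open>q\<^sub>j\<close>
  with \<open>j \<ge> d - d\<^sub>*\<close>.  Here \<open>g(s) = s\<^sup>2\<close> in the non-compact case and \<open>g(s) = 1 - cos s\<close> in the
  compact one.  Since \<open>g\<close> is even, the system is reversible, and the tori on which all these
  coordinates vanish form the required family.

  Since \<open>g \<ge> 0\<close>, the last coordinate \<open>q\<close> in the non-compact case, and \<open>tan (q/2)\<close> on the open set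
  \<open>q \<noteq> \<pi>\<close> in the compact case, is monotone along solutions.  By Dirichlet's approximation theorem
  conditionally periodic motions are recurrent, so a monotone continuous function is constant along
  them.  Hence the velocity vanishes on every Kronecker torus (contained in \<open>q \<noteq> \<pi>\<close> in the compact
  case), which therefore consists of points of the family.
\<close>


section \<open>Cosets and straightening charts\<close>

text \<open>The coset relation read one coordinate at a time. Membership in \<open>cls A x\<close>
  and equality of cosets split into such conditions, so a line and a circle can be handled by the
  same argument.\<close>

definition ceq :: "'i set \<Rightarrow> 'i \<Rightarrow> real \<Rightarrow> real \<Rightarrow> bool" where
  "ceq A i s t \<longleftrightarrow> (if i \<in> A then \<exists>k::int. t = s + 2 * pi * of_int k else t = s)"

lemma mem_cls: "y \<in> cls A x \<longleftrightarrow> (\<forall>i. ceq A i (x i) (y i))"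
  by (auto simp: cls_def ceq_def)

lemma ceq_refl [simp]: "ceq A i s s"
  by (auto simp: ceq_def intro: exI[of _ 0])

lemma ceq_sym: "ceq A i s t \<Longrightarrow> ceq A i t s"
  by (auto simp: ceq_def split: if_splits) (rule_tac x = "- k" in exI, simp)

lemma ceq_trans: "ceq A i r s \<Longrightarrow> ceq A i s t \<Longrightarrow> ceq A i r t"
  by (auto simp: ceq_def split: if_splits) (metis add.assoc distrib_left of_int_add)

lemma ceq_uminus: "ceq A i s t \<Longrightarrow> ceq A i (- s) (- t)"
  by (auto simp: ceq_def split: if_splits) (rule_tac x = "- k" in exI, simp)

lemma ceq_uminus_iff [simp]: "ceq A i (- s) (- t) \<longleftrightarrow> ceq A i s t"
  using ceq_uminus[of A i s t] ceq_uminus[of A i "- s" "- t"] by auto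

lemma cls_eq_iff: "cls A x = cls A y \<longleftrightarrow> (\<forall>i. ceq A i (x i) (y i))"
  by (metis (no_types, lifting) mem_cls ceq_refl ceq_sym ceq_trans set_eqI)

text \<open>Distinct equivalent reals differ by at least 2 pi. The bound 2 suits both uses: two
  points within distance 1 of a common centre, and the doubles of two numbers less than 1
  apart.\<close>

lemma ceq_close:
  assumes "ceq A i s t" "\<bar>s - t\<bar> < 2" shows "s = t"
proof (cases "i \<in> A")
  case True
  then obtain k :: int where k: "t = s + 2 * pi * of_int k"
    using assms by (auto simp: ceq_def)
  have "k = 0"
  proof (rule ccontr)
    assume "k \<noteq> 0"
    then have "1 \<le> \<bar>real_of_int k\<bar>" by linarith
    then have "2 * pi * 1 \<le> 2 * pi * \<bar>real_of_int k\<bar>" by (intro mult_left_mono) auto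
    also have "\<dots> = \<bar>s - t\<bar>" using k by (simp add: abs_mult)
    finally show False using assms(2) pi_gt3 by linarith
  qed
  then show ?thesis using k by simp
qed (use assms in \<open>auto simp: ceq_def\<close>)

lemma cls_self [simp]: "x \<in> cls A x"
  by (simp add: mem_cls)

lemma open_RR_Collect:
  assumes "open {x. Q x}" shows "open_RR I {x \<in> RR I. Q x}"
  unfolding open_RR_def openin_open using assms by blast

lemma open_box_fun:
  fixes x :: "'i \<Rightarrow> real"
  assumes "finite I" shows "open {y. \<forall>i\<in>I. \<bar>y i - x i\<bar> < r}"
proof -
  have "{y. \<forall>i\<in>I. \<bar>y i - x i\<bar> < r} = (\<Inter>i\<in>I. {y. \<bar>y i - x i\<bar> < r})" by auto
  moreover have "open {y :: 'i \<Rightarrow> real. \<bar>y i - x i\<bar> < r}" for i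
    by (intro open_Collect_less continuous_intros continuous_on_product_coordinates)
  ultimately show ?thesis using assms by auto
qed

section \<open>Smooth and analytic coordinates, and submanifolds given by discrete
  conditions\<close>

lemma smooth_fun_affine: "smooth_fun I V (\<lambda>y. s * y i + b)"
  unfolding smooth_fun_def
proof (intro exI conjI ballI allI)
  \<comment> \<open>The only nonzero derivative of positive order is the first one in direction
    \<open>i\<close>.\<close>
  define D :: "'a list \<Rightarrow> ('a \<Rightarrow> real) \<Rightarrow> real" where
    "D = (\<lambda>js x. case js of [] \<Rightarrow> s * x i + b | [j] \<Rightarrow> (if j = i then s else 0) | _ \<Rightarrow> 0)"
  show "D [] x = s * x i + b" for x by (simp add: D_def)
  have coord: "continuous_on V (\<lambda>x. x i)"
    by (rule continuous_on_subset[OF continuous_on_product_coordinates]) simp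
  show "continuous_on V (D js)" for js
  proof (cases js)
    case Nil
    then show ?thesis using coord by (auto simp: D_def intro!: continuous_intros)
  next
    case (Cons j ks)
    then show ?thesis by (cases ks) (auto simp: D_def)
  qed
  show "((\<lambda>t. D js (x(j := t))) has_real_derivative D (j # js) x) (at (x j))" for js j x
  proof (cases js)
    case Nil
    then show ?thesis by (auto simp: D_def intro!: derivative_eq_intros)
  next
    case (Cons j ks)
    then show ?thesis by (cases ks) (auto simp: D_def)
  qed
qed

lemma smooth_fun_const: "smooth_fun I V (\<lambda>y. b)"
  \<comment> \<open>With slope 0 any index will do, hence \<open>undefined\<close>.\<close>
  using smooth_fun_affine[of I V 0 undefined b] by simp

lemma smooth_fun_coord: "smooth_fun I V (\<lambda>y. y i)"
  using smooth_fun_affine[of I V 1 i 0] by simp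

text \<open>The power series about \<open>a\<close> has two terms: the constant
  \<open>a i + b\<close>, and the monomial with multi-index \<open>e\<close>, whose coefficient is
  1.\<close>

lemma analytic_fun_translation:
  assumes "finite I" "i \<in> I" shows "analytic_fun I V (\<lambda>y. y i + b)"
  unfolding analytic_fun_def
proof (intro ballI exI[of _ "1::real"] conjI)
  fix a assume "a \<in> V"
  define e :: "'a \<Rightarrow> nat" where "e = (\<lambda>j. if j = i then 1 else 0)"
  define c where "c = (\<lambda>\<alpha>. if \<alpha> = (\<lambda>_. 0) then a i + b else if \<alpha> = e then 1 else (0::real))"
  have e0: "e \<noteq> (\<lambda>_. 0)" by (auto simp: e_def fun_eq_iff)
  have "((\<lambda>\<alpha>. c \<alpha> * (\<Prod>j\<in>I. (x j - a j) ^ \<alpha> j)) has_sum x i + b) {\<alpha>. \<forall>j. j \<notin> I \<longrightarrow> \<alpha> j = 0}" for x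
  proof -
    have pe: "(\<Prod>j\<in>I. (x j - a j) ^ e j) = x i - a i"
      using assms by (simp add: e_def if_distrib[of "\<lambda>k. _ ^ k"] prod.delta cong: if_cong)
    have "((\<lambda>\<alpha>. c \<alpha> * (\<Prod>j\<in>I. (x j - a j) ^ \<alpha> j)) has_sum
        (\<Sum>\<alpha>\<in>{\<lambda>_. 0, e}. c \<alpha> * (\<Prod>j\<in>I. (x j - a j) ^ \<alpha> j))) {\<lambda>_. 0, e}"
      by (intro has_sum_finite) auto
    also have "(\<Sum>\<alpha>\<in>{\<lambda>_. 0, e}. c \<alpha> * (\<Prod>j\<in>I. (x j - a j) ^ \<alpha> j)) = x i + b"
      using e0 pe by (simp add: c_def)
    finally show ?thesis
      by (rule has_sum_cong_neutral[THEN iffD1, rotated -1]) (use assms in \<open>auto simp: c_def e_def\<close>)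
  qed
  then show "\<exists>c. \<forall>x\<in>V. (\<forall>i\<in>I. \<bar>x i - a i\<bar> < 1) \<longrightarrow>
        ((\<lambda>\<alpha>. c \<alpha> * (\<Prod>i\<in>I. (x i - a i) ^ \<alpha> i)) has_sum x i + b) {\<alpha>. \<forall>i. i \<notin> I \<longrightarrow> \<alpha> i = 0}"
    by blast
qed auto

text \<open>The translation by \<open>- x\<close> is already a straightening chart: within distance
  1 of \<open>x i\<close> the set \<open>E i\<close> contains only \<open>x i\<close>, so the
  condition \<open>y i \<in> E i\<close> becomes the vanishing of a chart coordinate. The class
  \<open>C\<close> is kept general so that the fixed point set, the tori (both smooth) and the
  families (analytic) are all covered.\<close>

lemma submanifold_discrete_slice:
  fixes C :: "'i set \<Rightarrow> ('i \<Rightarrow> real) set \<Rightarrow> (('i \<Rightarrow> real) \<Rightarrow> real) \<Rightarrow> bool"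
  assumes C: "\<And>V i b. i \<in> I \<Longrightarrow> C I V (\<lambda>y. y i + b)"
    and I: "finite I" and S: "S \<subseteq> cyl I A" and L: "L \<subseteq> I" "card L = d"
    and mem: "\<And>y. y \<in> RR I \<Longrightarrow> cls A y \<in> S \<longleftrightarrow> (\<forall>i\<in>I - L. y i \<in> E i)"
    and sep: "\<And>i s t. s \<in> E i \<Longrightarrow> t \<in> E i \<Longrightarrow> \<bar>s - t\<bar> < 1 \<Longrightarrow> s = t"
  shows "submanifold C I A d S"
  unfolding submanifold_def
proof (intro conjI ballI impI S)
  fix x assume x: "x \<in> RR I" "cls A x \<in> S"
  \<comment> \<open>Radius 1 serves two purposes: points of the box differ by less than 2 in each
    coordinate, so \<open>cls A\<close> is injective there, and \<open>sep\<close> applies to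
    \<open>y i\<close> and \<open>x i\<close>.\<close>
  define V where "V = {y \<in> RR I. \<forall>i\<in>I. \<bar>y i - x i\<bar> < 1}"
  define V' where "V' = {y \<in> RR I. \<forall>i\<in>I. \<bar>y i - 0\<bar> < 1}"
  define \<psi> where "\<psi> = (\<lambda>y i. y i + - x i)"
  define \<eta> where "\<eta> = (\<lambda>y i. y i + x i)"
  have x0: "i \<notin> I \<Longrightarrow> x i = 0" for i using x by (auto simp: RR_def)
  have "inj_on (cls A) V"
  proof (rule inj_onI, rule ext)
    fix y z i assume yz: "y \<in> V" "z \<in> V" "cls A y = cls A z"
    have "ceq A i (y i) (z i)" using yz by (simp add: cls_eq_iff)
    moreover have "\<bar>y i - z i\<bar> < 2"
    proof (cases "i \<in> I")
      case True
      then have "\<bar>y i - x i\<bar> < 1" "\<bar>z i - x i\<bar> < 1" using yz by (auto simp: V_def)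
      then show ?thesis by linarith
    qed (use yz in \<open>auto simp: V_def RR_def\<close>)
    ultimately show "y i = z i" by (rule ceq_close)
  qed
  moreover have "open_RR I V" "open_RR I V'"
    unfolding V_def V'_def using I by (intro open_RR_Collect open_box_fun; simp)+
  moreover have "x \<in> V" using x by (auto simp: V_def)
  moreover have "\<psi> ` V = V'"
  proof
    show "\<psi> ` V \<subseteq> V'" using x0 by (auto simp: V_def V'_def \<psi>_def RR_def)
    show "V' \<subseteq> \<psi> ` V"
    proof
      fix z assume "z \<in> V'"
      then have "\<eta> z \<in> V" "\<psi> (\<eta> z) = z"
        using x0 by (auto simp: V_def V'_def \<psi>_def \<eta>_def RR_def)
      then show "z \<in> \<psi> ` V" by (metis imageI)
    qed
  qed
  moreover have \<eta>\<psi>: "\<eta> (\<psi> y) = y" for y by (auto simp: \<psi>_def \<eta>_def)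
  moreover from \<open>\<psi> ` V = V'\<close> have "\<eta> ` V' = V" by (auto simp: image_image \<eta>\<psi>)
  moreover have "\<forall>i\<in>I. C I V (\<lambda>y. \<psi> y i)" "\<forall>i\<in>I. C I V' (\<lambda>y. \<eta> y i)"
    using C by (simp_all only: \<psi>_def \<eta>_def) blast+
  moreover have "\<forall>y\<in>V. cls A y \<in> S \<longleftrightarrow> (\<forall>i\<in>I - L. \<psi> y i = 0)"
  proof
    fix y assume y: "y \<in> V"
    have "y i \<in> E i \<longleftrightarrow> \<psi> y i = 0" if "i \<in> I - L" for i
    proof -
      have "x i \<in> E i" using mem x that by blast
      moreover have "\<bar>y i - x i\<bar> < 1" using y that by (auto simp: V_def)
      ultimately have "y i \<in> E i \<longleftrightarrow> y i = x i" using sep by metis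
      then show ?thesis by (simp add: \<psi>_def)
    qed
    then show "cls A y \<in> S \<longleftrightarrow> (\<forall>i\<in>I - L. \<psi> y i = 0)"
      using mem[of y] y by (auto simp: V_def)
  qed
  ultimately show "\<exists>V V' \<psi> \<eta> J. open_RR I V \<and> x \<in> V \<and> inj_on (cls A) V \<and> open_RR I V' \<and>
           \<psi> ` V = V' \<and> \<eta> ` V' = V \<and> (\<forall>y\<in>V. \<eta> (\<psi> y) = y) \<and>
           (\<forall>i\<in>I. C I V (\<lambda>y. \<psi> y i)) \<and> (\<forall>i\<in>I. C I V' (\<lambda>z. \<eta> z i)) \<and>
           J \<subseteq> I \<and> card J = d \<and>
           (\<forall>y\<in>V. cls A y \<in> S \<longleftrightarrow> (\<forall>i\<in>I - J. \<psi> y i = 0))"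
    using L
    by - (rule exI[of _ V], rule exI[of _ V'], rule exI[of _ \<psi>], rule exI[of _ \<eta>],
      rule exI[of _ L], intro conjI; (assumption | blast))
qed

lemma smooth_fun_continuous_on:
  assumes "smooth_fun I V f" shows "continuous_on V f"
proof -
  obtain D :: "'a list \<Rightarrow> ('a \<Rightarrow> real) \<Rightarrow> real"
    where "\<forall>x\<in>V. D [] x = f x" "continuous_on V (D [])"
    using assms unfolding smooth_fun_def by blast
  then show ?thesis using continuous_on_cong[of V V "D []" f] by simp
qed


section \<open>Recurrence on Kronecker tori\<close>

lemma tendsto_fun_iff:
  fixes X :: "'b \<Rightarrow> 'i \<Rightarrow> real"
  shows "(X \<longlongrightarrow> x) G \<longleftrightarrow> (\<forall>i. ((\<lambda>n. X n i) \<longlongrightarrow> x i) G)"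
  using limitin_componentwise[of "\<lambda>_. euclidean :: real topology" UNIV X x G]
  by (simp add: euclidean_product_topology)

text \<open>The function \<open>f\<close> of the coordinate \<open>c\<close> does not decrease along
  orbits in \<open>T\<close>, while recurrence brings it back arbitrarily close to its initial
  value; so it cannot increase at all. Periodicity lets \<open>f\<close> descend to cosets.
  Differentiability is asked for at points of \<open>T\<close> only, so that \<open>f\<close> may
  have poles elsewhere.\<close>

lemma kronecker_torus_stationary:
  fixes f f' :: "real \<Rightarrow> real"
  assumes kt: "kronecker_torus I A X k T" and c: "c \<in> I"
    and per: "\<And>s t. ceq A c s t \<Longrightarrow> f s = f t"
    and nonneg: "\<And>p. p \<in> T \<Longrightarrow> 0 \<le> X p c"
    and deriv: "\<And>x. cls A x \<in> T \<Longrightarrow> (f has_real_derivative f' (x c)) (at (x c))"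
    and pos: "\<And>x. cls A x \<in> T \<Longrightarrow> 0 < f' (x c)"
    and p: "p \<in> T"
  shows "X p c = 0"
proof -
  let ?K = "{..<k}"
  obtain h \<omega> where dif: "diffeomorphism ?K ?K (torus k) I A T h"
    and sol: "\<And>\<theta>. \<theta> \<in> RR ?K \<Longrightarrow> solution A X (\<lambda>t. h (cls ?K (\<lambda>j. \<theta> j + t * \<omega> j)))"
    and \<omega>: "\<omega> \<in> RR ?K"
    using kt unfolding kronecker_torus_def kronecker_torus_with_def by blast
  have bij: "bij_betw h (torus k) T" and sm: "smooth_map ?K ?K (torus k) I A h"
    using dif by (auto simp: diffeomorphism_def)
  \<comment> \<open>This is \<open>f\<close> as a function on cosets; by \<open>per\<close> the
    chosen representative does not matter.\<close>
  define \<Phi> where "\<Phi> = (\<lambda>p. f ((SOME x. x \<in> p) c))"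
  have \<Phi>: "\<Phi> (cls A x) = f (x c)" for x
  proof -
    have "(SOME y. y \<in> cls A x) \<in> cls A x" by (rule someI[of _ x]) simp
    then show ?thesis using per unfolding \<Phi>_def mem_cls by metis
  qed
  obtain \<theta> where \<theta>: "\<theta> \<in> RR ?K" "p = h (cls ?K \<theta>)"
    using bij p by (auto simp: bij_betw_def cyl_def)
  define \<gamma> where "\<gamma> = (\<lambda>t. h (cls ?K (\<lambda>j. \<theta> j + t * \<omega> j)))"
  have \<gamma>0: "\<gamma> 0 = p" by (simp add: \<gamma>_def \<theta>)
  have hT: "h (cls ?K y) \<in> T" if "y \<in> RR ?K" for y
    using bij that by (auto simp: bij_betw_def cyl_def)
  have \<gamma>T: "\<gamma> t \<in> T" for t
    unfolding \<gamma>_def by (intro hT) (use \<theta> \<omega> in \<open>auto simp: RR_def\<close>)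
  \<comment> \<open>The local lift depends on \<open>t\<close>, but the resulting derivative does
    have the sign of \<open>X (\<gamma> t) c\<close>, and that is all that monotonicity
    requires.\<close>
  have "\<exists>D>0. ((\<lambda>s. \<Phi> (\<gamma> s)) has_real_derivative D * X (\<gamma> t) c) (at t)" for t
  proof -
    have "has_velocity A \<gamma> (X (\<gamma> t)) t"
      using sol[OF \<theta>(1)] unfolding solution_def \<gamma>_def by blast
    then obtain F where F: "\<forall>\<^sub>F s in nhds t. \<gamma> s = cls A (F s)"
      "\<And>i. ((\<lambda>s. F s i) has_real_derivative X (\<gamma> t) i) (at t)"
      unfolding has_velocity_def by blast
    have Ft: "cls A (F t) \<in> T" using eventually_nhds_x_imp_x[OF F(1)] \<gamma>T by metis
    have "((\<lambda>s. f (F s c)) has_real_derivative f' (F t c) * X (\<gamma> t) c) (at t)"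
      by (rule DERIV_chain2[OF deriv[OF Ft] F(2)])
    moreover have "\<forall>\<^sub>F s in nhds t. \<Phi> (\<gamma> s) = f (F s c)"
      using F(1) by eventually_elim (simp add: \<Phi>)
    ultimately have "((\<lambda>s. \<Phi> (\<gamma> s)) has_real_derivative f' (F t c) * X (\<gamma> t) c) (at t)"
      by (subst DERIV_cong_ev[OF refl _ refl])
    then show ?thesis using pos[OF Ft] by blast
  qed
  then obtain D where D: "\<And>t. 0 < D t"
    "\<And>t. ((\<lambda>s. \<Phi> (\<gamma> s)) has_real_derivative D t * X (\<gamma> t) c) (at t)"
    by metis
  have mono: "\<Phi> (\<gamma> s) \<le> \<Phi> (\<gamma> t)" if "s \<le> t" for s t
  proof (rule DERIV_nonneg_imp_nondecreasing[OF that])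
    fix x
    have "0 \<le> D x * X (\<gamma> x) c" using D(1)[of x] nonneg[OF \<gamma>T[of x]] by simp
    then show "\<exists>y. ((\<lambda>s. \<Phi> (\<gamma> s)) has_real_derivative y) (at x) \<and> 0 \<le> y"
      using D(2)[of x] by blast
  qed

  \<comment> \<open>A local lift of \<open>h\<close> near \<open>\<theta>\<close>; only the
    continuity of its component \<open>c\<close> will be used.\<close>
  obtain V F where V: "open_RR ?K V" "\<theta> \<in> V" and F: "\<And>j. j \<in> I \<Longrightarrow> smooth_fun ?K V (\<lambda>y. F y j)"
    and hF: "\<And>y. y \<in> V \<Longrightarrow> cls ?K y \<in> torus k \<Longrightarrow> h (cls ?K y) = cls A (F y)"
    using sm \<theta>(1) unfolding smooth_map_def cyl_def by (metis image_eqI)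
  obtain U where U: "open U" "V = RR ?K \<inter> U"
    using V(1) unfolding open_RR_def openin_open by blast
  \<comment> \<open>Simultaneous approximation of the numbers \<open>\<omega> i / (2 * pi)\<close>
    gives positive integer times at which the linear flow on the torus nearly returns. No
    non-resonance of \<open>\<omega>\<close> is involved.\<close>
  have "\<exists>q P. (0::int) < q \<and> (\<forall>i<k. \<bar>of_int q * (\<omega> i / (2 * pi)) - of_int (P i)\<bar> < 1 / real (Suc N))" for N
  proof -
    obtain q P where "0 < q" "\<And>i. i < k \<Longrightarrow> \<bar>of_int q * (\<omega> i / (2 * pi)) - of_int (P i)\<bar> < 1 / real (Suc N)"
      using Dirichlet_approx_simult[of "Suc N" k "\<lambda>i. \<omega> i / (2 * pi)"] by blast
    then show ?thesis by blast
  qed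
  then obtain q P where q: "\<And>N. (0::int) < q N"
    and P: "\<And>N i. i < k \<Longrightarrow> \<bar>of_int (q N) * (\<omega> i / (2 * pi)) - of_int (P N i :: int)\<bar> < 1 / real (Suc N)"
    by metis
  \<comment> \<open>The point reached at time \<open>q N\<close>, with the multiples
    \<open>P N i\<close> of 2 pi removed so that the representatives converge to
    \<open>\<theta>\<close> and enter the domain of the lift.\<close>
  define y where "y = (\<lambda>N i. if i < k then \<theta> i + (of_int (q N) * \<omega> i - 2 * pi * of_int (P N i)) else 0)"
  have yRR: "y N \<in> RR ?K" for N by (auto simp: y_def RR_def)
  have lim0: "(\<lambda>N. of_int (q N) * \<omega> i - 2 * pi * of_int (P N i)) \<longlonglongrightarrow> 0" if "i < k" for i
  proof (rule Lim_null_comparison)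
    have "\<bar>of_int (q N) * \<omega> i - 2 * pi * of_int (P N i)\<bar> \<le> 2 * pi * (1 / real (Suc N))" for N
    proof -
      have "of_int (q N) * \<omega> i - 2 * pi * of_int (P N i)
          = 2 * pi * (of_int (q N) * (\<omega> i / (2 * pi)) - of_int (P N i))"
        by (simp add: right_diff_distrib)
      then have "\<bar>of_int (q N) * \<omega> i - 2 * pi * of_int (P N i)\<bar>
          = 2 * pi * \<bar>of_int (q N) * (\<omega> i / (2 * pi)) - of_int (P N i)\<bar>"
        by (simp only: abs_mult) simp
      also have "\<dots> \<le> 2 * pi * (1 / real (Suc N))"
        using P[OF that, of N] by (intro mult_left_mono) auto
      finally show ?thesis .
    qed
    then show "\<forall>\<^sub>F N in sequentially. norm (of_int (q N) * \<omega> i - 2 * pi * of_int (P N i)) \<le> 2 * pi * (1 / real (Suc N))"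
      by simp
    show "(\<lambda>N. 2 * pi * (1 / real (Suc N))) \<longlonglongrightarrow> 0"
      by (rule tendsto_mult_right_zero) (rule LIMSEQ_Suc[OF lim_1_over_n])
  qed
  have y\<theta>: "y \<longlonglongrightarrow> \<theta>"
    unfolding tendsto_fun_iff
  proof
    fix i show "(\<lambda>N. y N i) \<longlonglongrightarrow> \<theta> i"
    proof (cases "i < k")
      case True
      then show ?thesis using tendsto_add[OF tendsto_const lim0, of i "\<theta> i"] by (simp add: y_def)
    qed (use \<theta>(1) in \<open>simp add: y_def RR_def\<close>)
  qed
  have evV: "\<forall>\<^sub>F N in sequentially. y N \<in> V"
  proof -
    have "\<forall>\<^sub>F N in sequentially. y N \<in> U"
      using y\<theta> U V(2) by (auto dest: topological_tendstoD)
    then show ?thesis using yRR U(2) by simp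
  qed
  have hV: "h (cls ?K z) = cls A (F z)" if "z \<in> V" for z
    using hF[OF that] that U(2) by (auto simp: cyl_def)
  have "(\<lambda>N. F (y N) c) \<longlonglongrightarrow> F \<theta> c"
    by (rule continuous_on_tendsto_compose[OF smooth_fun_continuous_on[OF F[OF c]] y\<theta> V(2) evV])
  moreover have "isCont f (F \<theta> c)"
    using deriv[of "F \<theta>"] hV[OF V(2)] \<theta> p by (auto intro: DERIV_isCont)
  ultimately have "(\<lambda>N. f (F (y N) c)) \<longlonglongrightarrow> f (F \<theta> c)"
    by (metis isCont_tendsto_compose)
  moreover have "f (F \<theta> c) = \<Phi> (\<gamma> 0)"
    using hV[OF V(2)] \<theta> \<gamma>0 by (simp add: \<Phi>)
  \<comment> \<open>Return times are integers and so at least 1. Time 1 is thus a fixed bound from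
    below that survives the passage to the limit.\<close>
  moreover have "\<Phi> (\<gamma> 1) \<le> f (F (y N) c)" if "y N \<in> V" for N
  proof -
    have "cls ?K (y N) = cls ?K (\<lambda>j. \<theta> j + of_int (q N) * \<omega> j)"
      unfolding cls_eq_iff
    proof
      fix i
      show "ceq ?K i (y N i) (\<theta> i + of_int (q N) * \<omega> i)"
        using \<theta> \<omega> by (auto simp: ceq_def y_def RR_def)
    qed
    then have "cls A (F (y N)) = \<gamma> (of_int (q N))"
      using hV[OF that] by (simp add: \<gamma>_def)
    then have "f (F (y N) c) = \<Phi> (\<gamma> (of_int (q N)))" by (metis \<Phi>)
    moreover have "1 \<le> real_of_int (q N)" using q[of N] by simp
    ultimately show ?thesis using mono[of 1 "of_int (q N)"] by simp
  qed
  ultimately have le: "\<Phi> (\<gamma> 1) \<le> \<Phi> (\<gamma> 0)"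
    using evV by (intro tendsto_lowerbound[of _ _ sequentially]) (auto elim: eventually_mono)

  show ?thesis
  proof (rule ccontr)
    \<comment> \<open>A positive speed would raise the value strictly at some time \<open>r\<close>
      in (0, 1], against the inequality just obtained between the times 0 and 1.\<close>
    assume "X p c \<noteq> 0"
    then have "0 < D 0 * X (\<gamma> 0) c" using nonneg[OF p] D(1)[of 0] \<gamma>0 by simp
    then obtain e where e: "e > 0" "\<And>r. 0 < r \<Longrightarrow> r < e \<Longrightarrow> \<Phi> (\<gamma> 0) < \<Phi> (\<gamma> (0 + r))"
      using DERIV_pos_inc_right[OF D(2)[of 0]] by blast
    define r where "r = min 1 (e / 2)"
    have "0 < r" "r < e" "r \<le> 1" using e(1) by (auto simp: r_def)
    with e(2)[of r] mono[of r 1] le show False by simp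
  qed
qed


section \<open>The involution\<close>

lemma flip_simps [simp]:
  "flip x (Cu i) = x (Cu i)" "flip x (Cphi i) = - x (Cphi i)" "flip x (Cq i) = - x (Cq i)"
  by (simp_all add: flip_def)

lemma flip_flip [simp]: "flip (flip x) = x"
  by (auto simp: flip_def fun_eq_iff split: coord.split)

lemma flip_RR: "x \<in> RR I \<Longrightarrow> flip x \<in> RR I"
  by (auto simp: flip_def RR_def split: coord.split)

lemma ceq_flip: "ceq A c (x c) (y c) \<Longrightarrow> ceq A c (flip x c) (flip y c)"
  by (cases c) auto

text \<open>One inclusion holds for every point because negation respects cosets; the other is the
  same inclusion at \<open>flip x\<close>, as \<open>flip\<close> is its own inverse.\<close>

lemma GG_cls: "GG (cls A x) = cls A (flip x)"
proof -
  have sub: "flip ` cls A x \<subseteq> cls A (flip x)" for x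
    by (auto simp: mem_cls ceq_flip)
  have "cls A (flip x) \<subseteq> flip ` cls A x"
  proof
    fix y assume "y \<in> cls A (flip x)"
    then have "flip y \<in> cls A x" using sub[of "flip x"] by auto
    then show "y \<in> flip ` cls A x" by (metis flip_flip imageI)
  qed
  with sub show ?thesis unfolding GG_def by blast
qed

lemma finite_coords: "finite (uq_coords m l)" "finite (phi_coords n)" "finite (all_coords m n l)"
  by (simp_all add: all_coords_def uq_coords_def phi_coords_def)

lemma card_image_Un:
  "card (Cu ` S \<union> Cq ` T) = card S + card T" if "finite S" "finite T"
  using that by (subst card_Un_disjoint) (auto simp: card_image inj_on_def)

lemma card_all_coords: "card (all_coords m n l) = m + (n + l)"
  unfolding all_coords_def uq_coords_def phi_coords_def
  by (subst card_Un_disjoint) (auto simp: card_image_Un card_image inj_on_def)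

text \<open>Arbitrary \<open>A\<close> covers both phase spaces. A fixed coset satisfies
  \<open>- s\<close> equivalent to \<open>s\<close> in each \<open>\<phi>\<close> and
  \<open>q\<close> coordinate, which leaves only 0 on a line and the multiples of pi on a circle.
  The fixed point set is therefore a discrete slice in which exactly the \<open>u\<close>
  coordinates are free.\<close>

lemma involution_GG: "involution_of_type (all_coords m n l) A GG (n + l) m"
  unfolding involution_of_type_def
proof (intro conjI ballI)
  let ?I = "all_coords m n l"
  show "GG ` cyl ?I A \<subseteq> cyl ?I A"
    by (auto simp: cyl_def GG_cls flip_RR)
  show "GG (GG p) = p" if "p \<in> cyl ?I A" for p
    using that by (auto simp: cyl_def GG_cls)
  show "smooth_map ?I A (cyl ?I A) ?I A GG"
    unfolding smooth_map_def
  proof (intro ballI impI exI conjI)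
    show "open_RR ?I (RR ?I)" by (simp add: open_RR_def)
    show "flip ` RR ?I \<subseteq> RR ?I" by (auto simp: flip_RR)
    show "smooth_fun ?I (RR ?I) (\<lambda>y. flip y j)" for j
      using smooth_fun_affine[of ?I "RR ?I" "-1" j 0]
      by (cases j) (simp_all add: smooth_fun_coord)
  qed (simp_all add: GG_cls)
  have "cls A (\<lambda>_. 0) \<in> Fix ?I A GG"
    by (auto simp: Fix_def cyl_def RR_def GG_cls cls_eq_iff flip_def split: coord.split)
  then show "Fix ?I A GG \<noteq> {}" by blast
  define E where "E = (\<lambda>c. {s. ceq A c (- s) s})"
  show "submanifold smooth_fun ?I A m (Fix ?I A GG)"
  proof (rule submanifold_discrete_slice[where E = E and L = "Cu ` {..<m}"])
    show "smooth_fun ?I V (\<lambda>y. y i + b)" for V i b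
      using smooth_fun_affine[of ?I V 1 i b] by simp
    show "cls A y \<in> Fix ?I A GG \<longleftrightarrow> (\<forall>i\<in>?I - Cu ` {..<m}. y i \<in> E i)" if y: "y \<in> RR ?I" for y
    proof -
      have "cls A y \<in> Fix ?I A GG \<longleftrightarrow> (\<forall>c. ceq A c (flip y c) (y c))"
        using y by (auto simp: Fix_def cyl_def GG_cls cls_eq_iff)
      also have "\<dots> \<longleftrightarrow> (\<forall>c\<in>?I - Cu ` {..<m}. y c \<in> E c)"
      proof (intro iffI ballI allI)
        fix c assume *: "\<forall>c. ceq A c (flip y c) (y c)" "c \<in> ?I - Cu ` {..<m}"
        then have "ceq A c (flip y c) (y c)" by blast
        then show "y c \<in> E c" using *(2)
          by (cases c) (auto simp: E_def all_coords_def uq_coords_def phi_coords_def)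
      next
        fix c assume *: "\<forall>c\<in>?I - Cu ` {..<m}. y c \<in> E c"
        show "ceq A c (flip y c) (y c)"
        proof (cases "c \<in> ?I - Cu ` {..<m}")
          case True
          then have "y c \<in> E c" using * by blast
          then show ?thesis by (cases c) (auto simp: E_def)
        next
          case False
          then have "flip y c = y c"
            using y by (cases c) (auto simp: RR_def all_coords_def uq_coords_def phi_coords_def)
          then show ?thesis by simp
        qed
      qed
      finally show ?thesis .
    qed
    show "s = t" if st: "s \<in> E c" "t \<in> E c" and close: "\<bar>s - t\<bar> < 1" for c s t
    proof -
      \<comment> \<open>On a circle \<open>s\<close> and \<open>t\<close> are multiples of pi,
        possibly inequivalent; their doubles are multiples of 2 pi and still closer than 2.\<close>
      have "ceq A c (2 * s) (2 * t)"
      proof (cases "c \<in> A")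
        case True
        then obtain j k :: int where "s = - s + 2 * pi * of_int j" "t = - t + 2 * pi * of_int k"
          using st by (auto simp: E_def ceq_def)
        then have "2 * t = 2 * s + 2 * pi * of_int (k - j)" by (simp add: algebra_simps)
        then show ?thesis using True unfolding ceq_def by (simp only: if_True) blast
      qed (use st in \<open>auto simp: E_def ceq_def\<close>)
      from ceq_close[OF this] show ?thesis using close by simp
    qed
  qed (auto simp: finite_coords Fix_def all_coords_def uq_coords_def card_image inj_on_def)
  show "card ?I = m + (n + l)" by (rule card_all_coords)
qed


section \<open>The drift system\<close>

text \<open>The coordinates transverse to a family: the first \<open>a\<close> of the
  \<open>u\<close> and the first \<open>b\<close> of the \<open>q\<close> stay free, which gives
  dimension \<open>a + b\<close>.\<close>

definition normal_coords :: "nat \<Rightarrow> nat \<Rightarrow> nat \<Rightarrow> nat \<Rightarrow> coord set" where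
  "normal_coords m l a b = Cu ` {a..<m} \<union> Cq ` {b..<l}"

text \<open>Both phase spaces at once: the angles \<open>\<phi>\<close> always belong to
  \<open>A\<close>, while \<open>u\<close> and \<open>q\<close> may be lines or circles. The
  assumptions on \<open>g\<close> say that it is an even nonnegative function on each of these,
  vanishing exactly at the class of 0.\<close>

locale uq_drift =
  fixes m n l a b :: nat and A :: "coord set" and g :: "real \<Rightarrow> real" and \<omega> :: "nat \<Rightarrow> real"
  assumes l_pos: "1 \<le> l" and a_le: "a \<le> m" and b_le: "b \<le> l"
    and omega: "\<omega> \<in> RR {..<n}"
    and phi_A: "phi_coords n \<subseteq> A" and A_sub: "A \<subseteq> all_coords m n l"
    and g_even: "g (- s) = g s" and g_0: "g 0 = 0" and g_nonneg: "0 \<le> g s"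
    and g_cong: "c \<in> uq_coords m l \<Longrightarrow> ceq A c s t \<Longrightarrow> g s = g t"
    and g_zero: "c \<in> uq_coords m l \<Longrightarrow> g s = 0 \<Longrightarrow> ceq A c s 0"
begin

abbreviation "I \<equiv> all_coords m n l"
abbreviation "J \<equiv> uq_coords m l"
abbreviation "B \<equiv> A \<inter> J"

definition drift :: "(coord \<Rightarrow> real) \<Rightarrow> real" where
  "drift x = (\<Sum>c\<in>normal_coords m l a b. g (x c))"

definition field :: "(coord \<Rightarrow> real) \<Rightarrow> coord \<Rightarrow> real" where
  "field x c = (case c of Cu i \<Rightarrow> 0 | Cphi i \<Rightarrow> \<omega> i | Cq j \<Rightarrow> if Suc j = l then drift x else 0)"

text \<open>The choice of representative is harmless, since \<open>g_cong\<close> makes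
  \<open>field\<close> constant on cosets.\<close>

definition X :: "(coord \<Rightarrow> real) set \<Rightarrow> coord \<Rightarrow> real" where
  "X p = field (SOME x. x \<in> p)"

text \<open>The parameters are separate from those of the locale because two slices are needed:
  \<open>slice a b\<close> for the whole family and \<open>slice a 0\<close> for the symmetric
  subfamily.\<close>

definition slice :: "nat \<Rightarrow> nat \<Rightarrow> (coord \<Rightarrow> real) set set" where
  "slice a' b' = cls B ` {x \<in> RR J. \<forall>c\<in>normal_coords m l a' b'. x c = 0}"

definition emb :: "(coord \<Rightarrow> real) \<Rightarrow> (nat \<Rightarrow> real) \<Rightarrow> coord \<Rightarrow> real" where
  "emb z \<theta> c = (case c of Cphi i \<Rightarrow> \<theta> i | _ \<Rightarrow> z c)"

text \<open>The torus over \<open>z\<close> parametrized by \<open>\<phi>\<close>. All members of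
  \<open>\<Theta>\<close> contribute the same coset, so the union is a single coset; at
  \<open>z = 0\<close> this is \<open>phi_param A\<close>.\<close>

definition param :: "(coord \<Rightarrow> real) \<Rightarrow> (nat \<Rightarrow> real) set \<Rightarrow> (coord \<Rightarrow> real) set" where
  "param z \<Theta> = (\<Union>\<theta>\<in>\<Theta>. cls A (emb z \<theta>))"

lemma normal_sub: "normal_coords m l a' b' \<subseteq> J"
  by (auto simp: normal_coords_def uq_coords_def)

lemma ceq_B: "c \<in> J \<Longrightarrow> ceq B c s t \<longleftrightarrow> ceq A c s t"
  by (simp add: ceq_def)

lemma drift_cong:
  assumes "\<And>c. c \<in> J \<Longrightarrow> ceq A c (x c) (y c)" shows "drift x = drift y"
  unfolding drift_def using assms g_cong normal_sub by (intro sum.cong) blast+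

lemma field_cong:
  assumes "\<And>c. c \<in> J \<Longrightarrow> ceq A c (x c) (y c)" shows "field x = field y"
  using drift_cong[OF assms] by (auto simp: field_def fun_eq_iff split: coord.split)

lemma X_cls: "X (cls A x) = field x"
proof -
  have "(SOME y. y \<in> cls A x) \<in> cls A x" by (rule someI[of _ x]) simp
  then have "field x = field (SOME y. y \<in> cls A x)" by (intro field_cong) (simp add: mem_cls)
  then show ?thesis by (simp add: X_def)
qed

lemma field_RR: "field x \<in> RR I"
  using l_pos omega by (auto simp: field_def RR_def all_coords_def uq_coords_def phi_coords_def split: coord.split)

lemma vector_field_X: "vector_field I A X"
  by (auto simp: vector_field_def cyl_def X_cls field_RR)

lemma drift_flip: "drift (flip x) = drift x"
  unfolding drift_def
proof (rule sum.cong)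
  fix c show "g (flip x c) = g (x c)" by (cases c) (simp_all add: g_even)
qed simp

text \<open>Only \<open>\<phi>\<close> and \<open>q\<close> move, both are negated by the
  involution, and their velocities are unchanged under \<open>flip\<close> because \<open>g\<close>
  is even.\<close>

lemma reversible_X: "reversible I A X GG"
  unfolding reversible_def has_velocity_def GG_cls X_cls
proof (intro ballI exI conjI allI)
  fix x c
  show "((\<lambda>s. flip (\<lambda>i. x i + s * field x i) c) has_real_derivative - field (flip x) c) (at 0)"
    by (cases c) (auto simp: field_def drift_flip intro!: derivative_eq_intros)
qed auto

lemma drift_nonneg: "0 \<le> drift x"
  unfolding drift_def by (intro sum_nonneg) (simp add: g_nonneg)

lemma drift_zeroD:
  assumes "drift x = 0" "c \<in> normal_coords m l a b" shows "ceq A c (x c) 0"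
proof -
  have "g (x c) = 0"
    using assms unfolding drift_def
    by (subst (asm) sum_nonneg_eq_0_iff) (auto simp: g_nonneg normal_coords_def)
  then show ?thesis using g_zero normal_sub assms(2) by blast
qed

text \<open>A representative of a point of the slice vanishes in the normal coordinates only modulo
  2 pi; resetting those coordinates to 0 gives the representative that the definition asks
  for.\<close>

lemma cls_mem_slice:
  assumes y: "y \<in> RR J"
  shows "cls B y \<in> slice a' b' \<longleftrightarrow> (\<forall>c\<in>normal_coords m l a' b'. ceq A c (y c) 0)"
proof
  assume "cls B y \<in> slice a' b'"
  then obtain x where x: "\<forall>c\<in>normal_coords m l a' b'. x c = 0" "cls B y = cls B x"
    by (auto simp: slice_def)
  show "\<forall>c\<in>normal_coords m l a' b'. ceq A c (y c) 0"
  proof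
    fix c assume c: "c \<in> normal_coords m l a' b'"
    have "ceq B c (y c) (x c)" using x(2) by (simp add: cls_eq_iff)
    then show "ceq A c (y c) 0" using c x(1) ceq_B normal_sub by (metis subsetD)
  qed
next
  assume *: "\<forall>c\<in>normal_coords m l a' b'. ceq A c (y c) 0"
  define x where "x = (\<lambda>c. if c \<in> normal_coords m l a' b' then 0 else y c)"
  have "cls B y = cls B x"
    unfolding cls_eq_iff x_def using * normal_sub by (auto simp: ceq_B subset_iff)
  moreover have "x \<in> RR J" using y by (auto simp: x_def RR_def)
  ultimately show "cls B y \<in> slice a' b'" by (auto simp: slice_def x_def)
qed

lemma submanifold_slice:
  assumes "a' \<le> m" "b' \<le> l" shows "submanifold analytic_fun J B (a' + b') (slice a' b')"
proof -
  define N where "N = normal_coords m l a' b'"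
  have JN: "J - N = Cu ` {..<a'} \<union> Cq ` {..<b'}" "J - (J - N) = N"
    using assms by (auto simp: N_def normal_coords_def uq_coords_def image_iff not_le)
  show ?thesis
  proof (rule submanifold_discrete_slice[where L = "J - N" and E = "\<lambda>c. {s. ceq A c s 0}"])
    show "card (J - N) = a' + b'" by (simp add: JN card_image_Un)
    show "s = t" if "s \<in> {s. ceq A c s 0}" "t \<in> {s. ceq A c s 0}" "\<bar>s - t\<bar> < 1" for c s t
    proof -
      have "ceq A c s t" using that(1,2) by (metis ceq_sym ceq_trans mem_Collect_eq)
      then show ?thesis using that(3) by (intro ceq_close) auto
    qed
    show "cls B y \<in> slice a' b' \<longleftrightarrow> (\<forall>i\<in>J - (J - N). y i \<in> {s. ceq A i s 0})" if "y \<in> RR J" for y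
      unfolding JN(2) using cls_mem_slice[OF that] by (simp add: N_def)
    show "analytic_fun J V (\<lambda>y. y i + c)" if "i \<in> J" for V i c
      using that by (rule analytic_fun_translation[OF finite_coords(1)])
    show "slice a' b' \<subseteq> cyl J B" unfolding slice_def cyl_def by blast
  qed (simp_all add: finite_coords)
qed

lemma cls_mem_fibre:
  assumes x: "x \<in> RR I" and z: "z \<in> RR J"
  shows "cls A x \<in> fibre I A J B (cls B z) \<longleftrightarrow> (\<forall>c\<in>J. ceq A c (x c) (z c))"
proof -
  have *: "cls B (\<lambda>c. if c \<in> J then y c else 0) = cls B z \<longleftrightarrow> (\<forall>c\<in>J. ceq A c (y c) (z c))" for y
    unfolding cls_eq_iff
  proof (intro iffI ballI allI)
    fix c assume h: "\<forall>c. ceq B c (if c \<in> J then y c else 0) (z c)" and c: "c \<in> J"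
    then have "ceq B c (y c) (z c)" by (metis (full_types))
    then show "ceq A c (y c) (z c)" using c ceq_B by blast
  next
    fix c assume h: "\<forall>c\<in>J. ceq A c (y c) (z c)"
    show "ceq B c (if c \<in> J then y c else 0) (z c)"
      using h z by (cases "c \<in> J") (auto simp: ceq_B RR_def)
  qed
  show ?thesis
  proof
    assume "cls A x \<in> fibre I A J B (cls B z)"
    then obtain y where y: "cls A x = cls A y" "\<forall>c\<in>J. ceq A c (y c) (z c)"
      unfolding fibre_def using * by blast
    then show "\<forall>c\<in>J. ceq A c (x c) (z c)"
      unfolding cls_eq_iff by (meson ceq_trans)
  next
    assume "\<forall>c\<in>J. ceq A c (x c) (z c)"
    then show "cls A x \<in> fibre I A J B (cls B z)"
      unfolding fibre_def using * x by blast
  qed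
qed

lemma fibre_cyl: "fibre I A J B s \<subseteq> cyl I A"
  by (auto simp: fibre_def cyl_def)

lemma emb_simps [simp]: "emb z \<theta> (Cphi i) = \<theta> i" "emb z \<theta> (Cu i) = z (Cu i)" "emb z \<theta> (Cq i) = z (Cq i)"
  by (simp_all add: emb_def)

lemma emb_J: "c \<in> J \<Longrightarrow> emb z \<theta> c = z c"
  by (auto simp: uq_coords_def)

lemma emb_RR: "z \<in> RR J \<Longrightarrow> \<theta> \<in> RR {..<n} \<Longrightarrow> emb z \<theta> \<in> RR I"
  by (auto simp: emb_def RR_def all_coords_def uq_coords_def phi_coords_def split: coord.split)

lemma ceq_emb_iff: "ceq A (Cphi i) (\<theta> i) (\<theta>' i) \<longleftrightarrow> ceq {..<n} i (\<theta> i) (\<theta>' i)"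
proof -
  have "Cphi i \<in> A \<longleftrightarrow> i < n"
    using phi_A A_sub by (auto simp: all_coords_def uq_coords_def phi_coords_def)
  then show ?thesis by (simp add: ceq_def)
qed

text \<open>One direction makes \<open>param z\<close> well defined, the other makes it
  injective.\<close>

lemma cls_emb_eq_iff: "cls A (emb z \<theta>) = cls A (emb z \<theta>') \<longleftrightarrow> cls {..<n} \<theta> = cls {..<n} \<theta>'"
proof -
  have "(\<forall>c. ceq A c (emb z \<theta> c) (emb z \<theta>' c)) \<longleftrightarrow> (\<forall>i. ceq A (Cphi i) (\<theta> i) (\<theta>' i))"
  proof (intro iffI allI)
    fix i assume "\<forall>c. ceq A c (emb z \<theta> c) (emb z \<theta>' c)"
    then have "ceq A (Cphi i) (emb z \<theta> (Cphi i)) (emb z \<theta>' (Cphi i))" by blast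
    then show "ceq A (Cphi i) (\<theta> i) (\<theta>' i)" by simp
  next
    fix c assume "\<forall>i. ceq A (Cphi i) (\<theta> i) (\<theta>' i)"
    then show "ceq A c (emb z \<theta> c) (emb z \<theta>' c)" by (cases c) auto
  qed
  then show ?thesis by (simp add: cls_eq_iff ceq_emb_iff)
qed

lemma param_cls: "param z (cls {..<n} \<theta>) = cls A (emb z \<theta>)"
proof -
  have "cls A (emb z \<theta>') = cls A (emb z \<theta>)" if "\<theta>' \<in> cls {..<n} \<theta>" for \<theta>'
  proof -
    have "cls {..<n} \<theta> = cls {..<n} \<theta>'" using that by (simp add: cls_eq_iff mem_cls)
    then show ?thesis by (simp add: cls_emb_eq_iff)
  qed
  then show ?thesis unfolding param_def by (intro UN_constant_eq[OF cls_self] ballI)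
qed

text \<open>Where the drift vanishes, the field reduces to \<open>\<phi>' = \<omega>\<close> with
  \<open>u\<close> and \<open>q\<close> at rest, so the coordinate \<open>\<phi>\<close> itself
  linearizes the motion.\<close>

lemma kronecker_fibre:
  assumes z: "z \<in> RR J" and d0: "drift z = 0"
  shows "kronecker_torus_with I A X n (fibre I A J B (cls B z)) (param z) \<omega>"
  unfolding kronecker_torus_with_def
proof (intro conjI ballI omega)
  let ?T = "fibre I A J B (cls B z)" and ?K = "{..<n}"
  have II: "I - phi_coords n = J"
    by (auto simp: all_coords_def uq_coords_def phi_coords_def)
  show "submanifold smooth_fun I A n ?T"
  proof (rule submanifold_discrete_slice[where L = "phi_coords n" and E = "\<lambda>c. {s. ceq A c s (z c)}"])
    show "smooth_fun I V (\<lambda>y. y i + b)" for V i b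
      using smooth_fun_affine[of I V 1 i b] by simp
    show "s = t" if "s \<in> {s. ceq A c s (z c)}" "t \<in> {s. ceq A c s (z c)}" "\<bar>s - t\<bar> < 1" for c s t
    proof -
      have "ceq A c s t" using that(1,2) by (metis ceq_sym ceq_trans mem_Collect_eq)
      then show ?thesis using that(3) by (intro ceq_close) auto
    qed
    show "cls A y \<in> ?T \<longleftrightarrow> (\<forall>i\<in>I - phi_coords n. y i \<in> {s. ceq A i s (z i)})" if "y \<in> RR I" for y
      using cls_mem_fibre[OF that z] by (simp add: II)
    show "card (phi_coords n) = n" by (simp add: phi_coords_def card_image inj_on_def)
    show "phi_coords n \<subseteq> I" by (simp add: all_coords_def)
  qed (auto simp: finite_coords fibre_cyl)
  \<comment> \<open>Reads off the angles, with 0 beyond \<open>n\<close> to stay in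
    \<open>RR {..<n}\<close>. It is a global lift of the inverse of \<open>param z\<close>, as
    \<open>emb z\<close> is one of \<open>param z\<close>.\<close>
  define F :: "(coord \<Rightarrow> real) \<Rightarrow> nat \<Rightarrow> real" where "F = (\<lambda>x i. if i < n then x (Cphi i) else 0)"
  have F: "F x \<in> RR ?K" for x by (auto simp: F_def RR_def)
  have pF: "param z (cls ?K (F x)) = cls A x" if "x \<in> RR I" "cls A x \<in> ?T" for x
    unfolding param_cls cls_eq_iff
  proof
    fix c
    have J: "c \<in> J \<Longrightarrow> ceq A c (x c) (z c)" using that cls_mem_fibre[OF _ z] by blast
    show "ceq A c (emb z (F x) c) (x c)"
    proof (cases "c \<in> J")
      case True
      then show ?thesis using J by (simp add: emb_J ceq_sym)
    next
      case False
      then have "emb z (F x) c = x c"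
        using that(1) z by (cases c) (auto simp: F_def RR_def all_coords_def phi_coords_def)
      then show ?thesis by simp
    qed
  qed
  have pT: "param z (cls ?K \<theta>) \<in> ?T" if "\<theta> \<in> RR ?K" for \<theta>
    unfolding param_cls using cls_mem_fibre[OF emb_RR[OF z that] z] by (simp add: emb_J)
  have inj: "inj_on (param z) (torus n)"
    by (auto simp: inj_on_def cyl_def param_cls cls_emb_eq_iff)
  have bij: "bij_betw (param z) (torus n) ?T"
    unfolding bij_betw_def
  proof (intro conjI inj subset_antisym subsetI)
    fix p assume p: "p \<in> ?T"
    then obtain x where "p = cls A x" "x \<in> RR I" by (auto simp: fibre_def)
    then have "p = param z (cls ?K (F x))" using pF p by simp
    then show "p \<in> param z ` torus n" using F by (auto simp: cyl_def)
  qed (auto simp: cyl_def pT)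
  show "diffeomorphism ?K ?K (torus n) I A ?T (param z)"
    unfolding diffeomorphism_def smooth_map_def
  proof (intro conjI bij ballI impI exI)
    show "open_RR ?K (RR ?K)" "open_RR I (RR I)" by (simp_all add: open_RR_def)
    show "emb z ` RR ?K \<subseteq> RR I" using emb_RR[OF z] by blast
    show "smooth_fun ?K (RR ?K) (\<lambda>y. emb z y c)" for c
      by (cases c) (simp_all add: smooth_fun_coord smooth_fun_const)
    show "F ` RR I \<subseteq> RR ?K" using F by blast
    show "smooth_fun I (RR I) (\<lambda>y. F y i)" for i
      by (cases "i < n") (simp_all add: F_def smooth_fun_coord smooth_fun_const)
    show "the_inv_into (torus n) (param z) (cls A x) = cls ?K (F x)" if "x \<in> RR I" "cls A x \<in> ?T" for x
      using F by (intro the_inv_into_f_eq[OF inj pF[OF that]]) (auto simp: cyl_def)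
  qed (auto simp: param_cls)
  show "solution A X (\<lambda>t. param z (cls ?K (\<lambda>j. \<theta> j + t * \<omega> j)))" if "\<theta> \<in> RR ?K" for \<theta>
    unfolding solution_def has_velocity_def param_cls X_cls
  proof (intro allI exI conjI)
    fix t c
    have "drift (emb z (\<lambda>j. \<theta> j + t * \<omega> j)) = 0"
      using d0 drift_cong[of "emb z (\<lambda>j. \<theta> j + t * \<omega> j)" z] by (simp add: emb_J)
    then show "((\<lambda>s. emb z (\<lambda>j. \<theta> j + s * \<omega> j) c) has_real_derivative
        field (emb z (\<lambda>j. \<theta> j + t * \<omega> j)) c) (at t)"
      by (cases c) (auto simp: field_def intro!: derivative_eq_intros)
  qed auto
qed

end

section \<open>Polynomial and trigonometric polynomial right-hand sides\<close>

lemma polynomial_in_const: "polynomial_in I J (\<lambda>x. b)"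
  unfolding polynomial_in_def
  by (intro exI[of _ "{\<lambda>_. 0}"] exI[of _ "\<lambda>_. b"]) simp

lemma polynomial_in_sum_squares:
  assumes "finite J" "K \<subseteq> J" shows "polynomial_in I J (\<lambda>x. \<Sum>j\<in>K. (x j)\<^sup>2)"
  unfolding polynomial_in_def
proof (intro exI conjI ballI)
  \<comment> \<open>The exponent of the square of the variable \<open>j\<close>; injectivity turns
    the sum over variables into a sum over exponents.\<close>
  define e :: "'a \<Rightarrow> 'a \<Rightarrow> nat" where "e = (\<lambda>j i. if i = j then 2 else 0)"
  have inj: "inj_on e K" by (auto simp: inj_on_def e_def fun_eq_iff split: if_splits)
  show "finite (e ` K)" using assms finite_subset by blast
  fix x :: "'a \<Rightarrow> real"
  have "(\<Prod>i\<in>J. x i ^ e j i) = (x j)\<^sup>2" if "j \<in> K" for j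
  proof -
    have "(\<Prod>i\<in>J. x i ^ e j i) = (\<Prod>i\<in>J. if i = j then (x j)\<^sup>2 else 1)"
      by (intro prod.cong) (auto simp: e_def)
    then show ?thesis using that assms by (auto simp: prod.delta)
  qed
  then show "(\<Sum>j\<in>K. (x j)\<^sup>2) = (\<Sum>\<alpha>\<in>e ` K. 1 * (\<Prod>i\<in>J. x i ^ \<alpha> i))"
    by (simp add: sum.reindex[OF inj])
qed

lemma trig_polynomial_in_const: "trig_polynomial_in I J (\<lambda>x. b)"
  unfolding trig_polynomial_in_def
  by (intro exI[of _ "{\<lambda>_. 0}"] exI[of _ "\<lambda>_. b"] exI[of _ "\<lambda>_. 0"]) simp

lemma trig_polynomial_in_sum_one_minus_cos:
  assumes "finite J" "K \<subseteq> J" shows "trig_polynomial_in I J (\<lambda>x. \<Sum>j\<in>K. 1 - cos (x j))"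
  unfolding trig_polynomial_in_def
proof (intro exI conjI ballI)
  define e :: "'a \<Rightarrow> 'a \<Rightarrow> int" where "e = (\<lambda>j i. if i = j then 1 else 0)"
  \<comment> \<open>The frequency 0 collects the constants 1, one for each element of
    \<open>K\<close>; each \<open>e j\<close> carries one term with coefficient -1.\<close>
  define a :: "('a \<Rightarrow> int) \<Rightarrow> real" where "a = (\<lambda>\<alpha>. if \<alpha> = (\<lambda>_. 0) then real (card K) else - 1)"
  have inj: "inj_on e K" by (auto simp: inj_on_def e_def fun_eq_iff split: if_splits)
  have e0: "e j \<noteq> (\<lambda>_. 0)" for j by (auto simp: e_def fun_eq_iff)
  have K: "finite K" using assms finite_subset by blast
  then show "finite (insert (\<lambda>_. 0) (e ` K))" by blast
  fix x :: "'a \<Rightarrow> real"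
  have "(\<Sum>i\<in>J. of_int (e j i) * x i) = x j" if "j \<in> K" for j
  proof -
    have "(\<Sum>i\<in>J. of_int (e j i) * x i) = (\<Sum>i\<in>J. if i = j then x j else 0)"
      by (intro sum.cong) (auto simp: e_def)
    then show ?thesis using that assms by (auto simp: sum.delta)
  qed
  moreover have "(\<lambda>_. 0) \<notin> e ` K" using e0 by (metis imageE)
  ultimately show "(\<Sum>j\<in>K. 1 - cos (x j)) =
      (\<Sum>k\<in>insert (\<lambda>_. 0) (e ` K). a k * cos (\<Sum>j\<in>J. of_int (k j) * x j)
          + 0 * sin (\<Sum>j\<in>J. of_int (k j) * x j))"
    using K e0 by (simp add: sum.reindex[OF inj] a_def sum_subtractf sum_negf)
qed

lemma ceq_cos:
  assumes "ceq A c s t" shows "cos s = cos t"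
proof (cases "c \<in> A")
  case True
  then obtain k :: int where "t = s + 2 * pi * of_int k" using assms by (auto simp: ceq_def)
  then show ?thesis by (simp add: cos_add)
qed (use assms in \<open>simp add: ceq_def\<close>)

text \<open>The half angle turns the period pi of the tangent into 2 pi, so this increasing function
  lives on the circle without the point pi.\<close>

lemma ceq_tan_half:
  assumes "ceq A c s t" shows "tan (s / 2) = tan (t / 2)"
proof (cases "c \<in> A")
  case True
  then obtain k :: int where "t = s + 2 * pi * of_int k" using assms by (auto simp: ceq_def)
  then have "t / 2 = s / 2 + of_int k * pi" by simp
  then show ?thesis by (simp only: tan_periodic_int)
qed (use assms in \<open>simp add: ceq_def\<close>)

text \<open>Both isolation arguments show that a torus avoiding the origin torus would have to meet
  it; for a contradiction it must have a point.\<close>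

lemma kronecker_torus_nonempty:
  assumes "kronecker_torus I A X k T" obtains x where "x \<in> RR I" "cls A x \<in> T"
proof -
  obtain h where "bij_betw h (torus k) T" and sub: "T \<subseteq> cyl I A"
    using assms unfolding kronecker_torus_def kronecker_torus_with_def diffeomorphism_def submanifold_def
    by blast
  moreover have "cls {..<k} (\<lambda>_. 0) \<in> torus k" by (auto simp: cyl_def RR_def)
  ultimately have "h (cls {..<k} (\<lambda>_. 0)) \<in> T" by (auto simp: bij_betw_def)
  with sub that show thesis by (auto simp: cyl_def)
qed

section \<open>Families of tori, symmetry and isolation\<close>

context uq_drift
begin

abbreviation "origin_torus \<equiv> fibre I A J B (cls B (\<lambda>_. 0))"

lemma zero_RR: "(\<lambda>_. 0) \<in> RR K"
  by (simp add: RR_def)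

lemma slice_drift:
  assumes "a' \<le> a" "b' \<le> b" "\<forall>c\<in>normal_coords m l a' b'. z c = 0" shows "drift z = 0"
  unfolding drift_def
proof (rule sum.neutral, rule ballI)
  fix c assume "c \<in> normal_coords m l a b"
  then have "z c = 0" using assms by (auto simp: normal_coords_def)
  then show "g (z c) = 0" by (simp add: g_0)
qed

lemma slice_mono: "a' \<le> a \<Longrightarrow> b' \<le> b \<Longrightarrow> slice a' b' \<subseteq> slice a b"
  unfolding slice_def normal_coords_def by (intro image_mono) auto

lemma analytic_family_slice:
  assumes "a' \<le> a" "b' \<le> b" shows "analytic_family I A J B X n (a' + b') (slice a' b')"
  unfolding analytic_family_def
proof (intro conjI ballI)
  show "submanifold analytic_fun J B (a' + b') (slice a' b')"
    using assms a_le b_le by (intro submanifold_slice) auto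
  fix s assume "s \<in> slice a' b'"
  then show "kronecker_torus I A X n (fibre I A J B s)"
    unfolding kronecker_torus_def slice_def using kronecker_fibre slice_drift[OF assms] by blast
qed

lemma origin_mem_slice: "cls B (\<lambda>_. 0) \<in> slice a' b'"
  using zero_RR by (auto simp: slice_def)

lemma param_origin: "param (\<lambda>_. 0) = phi_param A"
proof -
  have "emb (\<lambda>_. 0) \<theta> = (\<lambda>c. case c of Cphi i \<Rightarrow> \<theta> i | _ \<Rightarrow> 0)" for \<theta>
    by (rule ext) (simp add: emb_def)
  then show ?thesis by (intro ext) (simp add: param_def phi_param_def)
qed

lemma kronecker_origin_torus: "kronecker_torus_with I A X n origin_torus (phi_param A) \<omega>"
  using kronecker_fibre[OF zero_RR slice_drift[of a b]] by (simp add: param_origin)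

text \<open>With \<open>q = 0\<close> the base point is fixed by \<open>flip\<close>, so the fibre
  is mapped into itself, and onto itself because \<open>GG\<close> is an involution.\<close>

lemma GG_fibre:
  assumes z: "z \<in> RR J" and q: "\<forall>j<l. z (Cq j) = 0"
  shows "GG ` fibre I A J B (cls B z) = fibre I A J B (cls B z)" (is "GG ` ?T = ?T")
proof -
  have fz: "flip z = z"
  proof
    fix c show "flip z c = z c"
      using z q by (cases c) (auto simp: RR_def uq_coords_def)
  qed
  have sub: "GG p \<in> ?T \<and> GG (GG p) = p" if p: "p \<in> ?T" for p
  proof -
    obtain x where x: "p = cls A x" "x \<in> RR I" using p unfolding fibre_def by blast
    then have "\<forall>c\<in>J. ceq A c (x c) (z c)" using p cls_mem_fibre[OF _ z] by blast
    then have "\<forall>c\<in>J. ceq A c (flip x c) (z c)" using ceq_flip fz by metis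
    then show ?thesis using x cls_mem_fibre[OF flip_RR z] by (simp add: GG_cls)
  qed
  show ?thesis
  proof
    show "GG ` ?T \<subseteq> ?T" using sub by blast
    show "?T \<subseteq> GG ` ?T" using sub by (metis imageI subsetI)
  qed
qed

lemma slice_symmetric:
  assumes "s \<in> slice a' 0"
  shows "GG ` fibre I A J B s = fibre I A J B s \<and> (\<exists>y\<in>s. \<forall>j<l. y (Cq j) = 0)"
proof -
  obtain z where z: "s = cls B z" "z \<in> RR J" "\<forall>j<l. z (Cq j) = 0"
    using assms by (auto simp: slice_def normal_coords_def)
  then show ?thesis using GG_fibre[OF z(2,3)] cls_self by blast
qed

lemma slice_full: "slice m l = cyl J B"
  by (simp add: slice_def cyl_def normal_coords_def)

lemma slice_origin: "slice 0 0 = {cls B (\<lambda>_. 0)}"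
proof -
  have "normal_coords m l 0 0 = J"
    by (simp add: normal_coords_def uq_coords_def lessThan_atLeast0)
  then have "{x \<in> RR J. \<forall>c\<in>normal_coords m l 0 0. x c = 0} = {\<lambda>_. 0}"
    unfolding RR_def by auto
  then show ?thesis by (simp add: slice_def)
qed

lemma X_last: "X p (Cq (l - 1)) = drift (SOME x. x \<in> p)"
  using l_pos by (simp add: X_def field_def)

text \<open>The last \<open>q\<close> stands still only where the drift is zero, hence where every
  normal coordinate is equivalent to 0; the \<open>(u, q)\<close> part of \<open>x\<close> then is
  the parameter of a torus of the family.\<close>

lemma stationary_mem_fibre:
  assumes x: "x \<in> RR I" and X0: "X (cls A x) (Cq (l - 1)) = 0"
  shows "cls A x \<in> (\<Union>s\<in>slice a b. fibre I A J B s)"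
proof -
  have d: "drift x = 0" using X0 l_pos by (simp add: X_cls field_def)
  define z where "z = (\<lambda>c. if c \<in> J then x c else 0)"
  have z: "z \<in> RR J" by (simp add: z_def RR_def)
  have "ceq A c (z c) 0" if "c \<in> normal_coords m l a b" for c
  proof -
    have "z c = x c" using that normal_sub by (auto simp: z_def)
    then show ?thesis using drift_zeroD[OF d that] by simp
  qed
  then have "cls B z \<in> slice a b" using cls_mem_slice[OF z] by blast
  moreover have "cls A x \<in> fibre I A J B (cls B z)"
    using cls_mem_fibre[OF x z] by (simp add: z_def)
  ultimately show ?thesis by blast
qed

text \<open>If the last \<open>q\<close> is a line coordinate, it serves itself as the monotone
  function.\<close>

lemma kronecker_torus_subset_fibres:
  assumes line: "Cq (l - 1) \<notin> A" and T: "kronecker_torus I A X k T"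
  shows "T \<subseteq> (\<Union>s\<in>slice a b. fibre I A J B s)"
proof
  fix p assume p: "p \<in> T"
  have "T \<subseteq> cyl I A"
    using T unfolding kronecker_torus_def kronecker_torus_with_def submanifold_def by blast
  then obtain x where x: "p = cls A x" "x \<in> RR I" using p by (auto simp: cyl_def)
  have "X p (Cq (l - 1)) = 0"
  proof (rule kronecker_torus_stationary[OF T, where f = "\<lambda>s. s" and f' = "\<lambda>_. 1"])
    show "Cq (l - 1) \<in> I" using l_pos by (simp add: all_coords_def uq_coords_def)
    show "0 \<le> X p (Cq (l - 1))" for p by (simp only: X_last drift_nonneg)
  qed (use line p in \<open>simp_all add: ceq_def\<close>)
  then show "p \<in> (\<Union>s\<in>slice a b. fibre I A J B s)"
    using stationary_mem_fibre x by blast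
qed

lemma unique_origin_torus:
  assumes "a = 0" "b = 0" "Cq (l - 1) \<notin> A" shows "unique_torus I A X origin_torus"
  unfolding unique_torus_def
proof
  assume "\<exists>k T. kronecker_torus I A X k T \<and> T \<subseteq> cyl I A - origin_torus"
  then obtain k T where T: "kronecker_torus I A X k T" "T \<subseteq> cyl I A - origin_torus" by blast
  have "T \<subseteq> origin_torus"
    using kronecker_torus_subset_fibres[OF assms(3) T(1)] assms(1,2) slice_origin by simp
  then show False using T kronecker_torus_nonempty by blast
qed

text \<open>On a full circle, orbits with nonzero drift may go round and recur. Removing
  \<open>q = pi\<close> in the last coordinate makes \<open>tan (q / 2)\<close> available as the
  monotone function, and for \<open>a = b = 0\<close> the family is the origin torus alone.\<close>

lemma strongly_isolated_origin_torus:
  assumes ab: "a = 0" "b = 0" shows "strongly_isolated I A X origin_torus"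
  unfolding strongly_isolated_def
proof (intro exI conjI notI)
  define c where "c = Cq (l - 1)"
  have cI: "c \<in> I" "c \<in> J" using l_pos by (simp_all add: c_def all_coords_def uq_coords_def)
  \<comment> \<open>The cosine expresses that the last \<open>q\<close> is not pi modulo 2 pi,
    independently of the representative.\<close>
  define W where "W = cls A ` {x \<in> RR I. cos (x c) \<noteq> - 1}"
  have mem: "cos (x c) \<noteq> - 1" if xW: "cls A x \<in> W" for x
  proof -
    obtain z where z: "cls A x = cls A z" "cos (z c) \<noteq> - 1" using xW by (auto simp: W_def)
    then have "cos (x c) = cos (z c)" using ceq_cos cls_eq_iff by metis
    then show ?thesis using z(2) by simp
  qed
  have W: "cls A x \<in> W" if "x \<in> RR I" "cos (x c) \<noteq> - 1" for x
    unfolding W_def using that by blast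
  have "W \<subseteq> cyl I A" unfolding W_def cyl_def by blast
  moreover have "{x \<in> RR I. cls A x \<in> W} = {x \<in> RR I. cos (x c) \<noteq> - 1}"
    using mem W by blast
  moreover have "open {x :: coord \<Rightarrow> real. cos (x c) \<noteq> - 1}"
  proof (rule open_Collect_neq)
    show "continuous_on UNIV (\<lambda>x :: coord \<Rightarrow> real. cos (x c))"
      by (rule continuous_on_compose2[OF continuous_on_cos[OF continuous_on_id]
            continuous_on_product_coordinates subset_UNIV])
  qed (rule continuous_on_const)
  ultimately show "open_cyl I A W"
    unfolding open_cyl_def by (simp add: open_RR_Collect)
  show "origin_torus \<subseteq> W"
  proof
    fix p assume p: "p \<in> origin_torus"
    then obtain x where x: "p = cls A x" "x \<in> RR I" unfolding fibre_def by blast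
    then have "ceq A c (x c) 0" using p cls_mem_fibre[OF _ zero_RR] cI by blast
    then have "cos (x c) = 1" using ceq_cos[of A c "x c" 0] by simp
    then show "p \<in> W" using x W by simp
  qed
  assume "\<exists>k T. kronecker_torus I A X k T \<and> T \<subseteq> W - origin_torus"
  then obtain k T where T: "kronecker_torus I A X k T" "T \<subseteq> W - origin_torus" by blast
  obtain x where x: "x \<in> RR I" "cls A x \<in> T" using kronecker_torus_nonempty[OF T(1)] .
  \<comment> \<open>By the double angle formula; this is what makes \<open>tan (s / 2)\<close>
    differentiable at the points of \<open>T\<close>.\<close>
  have cosT: "cos (y c / 2) \<noteq> 0" if "cls A y \<in> T" for y
  proof
    assume "cos (y c / 2) = 0"
    then have "cos (y c) = - 1" using cos_double_cos[of "y c / 2"] by simp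
    then show False using mem T(2) that by blast
  qed
  have "X (cls A x) c = 0"
  proof (rule kronecker_torus_stationary[OF T(1) cI(1) _ _ _ _ x(2)])
    show "tan (s / 2) = tan (t / 2)" if "ceq A c s t" for s t
      using that by (rule ceq_tan_half)
    show "0 \<le> X p c" for p by (simp only: c_def X_last drift_nonneg)
    show "((\<lambda>s. tan (s / 2)) has_real_derivative inverse ((cos (y c / 2))\<^sup>2) / 2) (at (y c))"
      if "cls A y \<in> T" for y
      using cosT[OF that] by (auto intro!: derivative_eq_intros)
    show "0 < inverse ((cos (y c / 2))\<^sup>2) / 2" if "cls A y \<in> T" for y
      using cosT[OF that] by simp
  qed
  then have "cls A x \<in> origin_torus"
    using stationary_mem_fibre[OF x(1)] ab slice_origin by (simp add: c_def)
  then show False using T(2) x(2) by blast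
qed

end

section \<open>The non-compact and the compact instance\<close>

lemma coord_sets_Int:
  "phi_coords n \<inter> uq_coords m l = {}" "all_coords m n l \<inter> uq_coords m l = uq_coords m l"
  by (auto simp: all_coords_def uq_coords_def phi_coords_def)

text \<open>The truncated difference \<open>d - ds\<close> is exact because
  \<open>ds \<le> d\<close>, and it is at most \<open>l\<close> because
  \<open>d \<le> ds + l\<close>.\<close>

lemma uq_drift_square:
  assumes "l \<ge> 1" "ds \<le> m" "ds \<le> d" "d \<le> ds + l" "\<omega> \<in> RR {..<n}"
  shows "uq_drift m n l ds (d - ds) (phi_coords n) power2 \<omega>"
proof unfold_locales
  fix c s t assume "c \<in> uq_coords m l"
  then have "c \<notin> phi_coords n" by (auto simp: uq_coords_def phi_coords_def)
  then show "ceq (phi_coords n) c s t \<Longrightarrow> s\<^sup>2 = t\<^sup>2" "s\<^sup>2 = 0 \<Longrightarrow> ceq (phi_coords n) c s 0"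
    by (simp_all add: ceq_def)
qed (use assms in \<open>auto simp: all_coords_def\<close>)

text \<open>Every coordinate is now angular, and the zeros of \<open>1 - cos s\<close>, the
  multiples of 2 pi, form the class of 0.\<close>

lemma uq_drift_one_minus_cos:
  assumes "l \<ge> 1" "ds \<le> m" "ds \<le> d" "d \<le> ds + l" "\<omega> \<in> RR {..<n}"
  shows "uq_drift m n l ds (d - ds) (all_coords m n l) (\<lambda>s. 1 - cos s) \<omega>"
proof unfold_locales
  show "ceq (all_coords m n l) c s 0" if c: "c \<in> uq_coords m l" and s: "1 - cos s = 0" for c s
  proof -
    obtain k :: int where "s = of_int k * 2 * pi" using s cos_one_2pi_int[of s] by auto
    then have "0 = s + 2 * pi * of_int (- k)" by simp
    then show ?thesis using c unfolding ceq_def all_coords_def by (metis UnI1)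
  qed
qed (use assms ceq_cos in \<open>auto simp: all_coords_def\<close>)

theorem theorem2:
  fixes n m l ds d :: nat and \<omega> :: "nat \<Rightarrow> real"
  assumes "l \<ge> 1" and "ds \<le> m" and "ds \<le> d" and "d \<le> ds + l"
    and "\<omega> \<in> RR {..<n}"
  defines "I \<equiv> all_coords m n l" and "J \<equiv> uq_coords m l" and "P \<equiv> phi_coords n"
  shows
    "(involution_of_type I P GG (n + l) m \<and>
      (\<exists>X. vector_field I P X \<and> reversible I P X GG \<and>
         (\<forall>c\<in>I. polynomial_in I J (\<lambda>x. X (cls P x) c)) \<and>
         (\<exists>S Ss.
            analytic_family I P J {} X n d S \<and>
            (\<forall>k T. kronecker_torus I P X k T \<longrightarrow> T \<subseteq> (\<Union>s\<in>S. fibre I P J {} s)) \<and>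
            Ss \<subseteq> S \<and> analytic_family I P J {} X n ds Ss \<and>
            (\<forall>s\<in>Ss. GG ` fibre I P J {} s = fibre I P J {} s \<and>
                     (\<exists>y\<in>s. \<forall>j<l. y (Cq j) = 0)) \<and>
            cls {} (\<lambda>_. 0) \<in> Ss \<and>
            kronecker_torus_with I P X n (fibre I P J {} (cls {} (\<lambda>_. 0))) (phi_param P) \<omega> \<and>
            (ds = 0 \<and> d = 0 \<longrightarrow> unique_torus I P X (fibre I P J {} (cls {} (\<lambda>_. 0)))) \<and>
            (ds = m \<and> d = m + l \<longrightarrow> S = cyl J {}))))
     \<and>
     (involution_of_type I I GG (n + l) m \<and>
      (\<exists>X. vector_field I I X \<and> reversible I I X GG \<and>
         (\<forall>c\<in>I. trig_polynomial_in I J (\<lambda>x. X (cls I x) c)) \<and>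
         (\<exists>S Ss.
            analytic_family I I J J X n d S \<and>
            Ss \<subseteq> S \<and> analytic_family I I J J X n ds Ss \<and>
            (\<forall>s\<in>Ss. GG ` fibre I I J J s = fibre I I J J s \<and>
                     (\<exists>y\<in>s. \<forall>j<l. y (Cq j) = 0 \<or> y (Cq j) = pi)) \<and>
            cls J (\<lambda>_. 0) \<in> Ss \<and>
            kronecker_torus_with I I X n (fibre I I J J (cls J (\<lambda>_. 0))) (phi_param I) \<omega> \<and>
            (ds = 0 \<and> d = 0 \<longrightarrow> strongly_isolated I I X (fibre I I J J (cls J (\<lambda>_. 0)))) \<and>
            (ds = m \<and> d = m + l \<longrightarrow> S = cyl J J))))"
proof -
  interpret A: uq_drift m n l ds "d - ds" P power2 \<omega>
    unfolding P_def using assms(1-5) by (rule uq_drift_square)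
  interpret B: uq_drift m n l ds "d - ds" I "\<lambda>s. 1 - cos s" \<omega>
    unfolding I_def using assms(1-5) by (rule uq_drift_one_minus_cos)
  \<comment> \<open>These turn the locale's \<open>A \<inter> J\<close> into the sets
    \<open>{}\<close> and \<open>J\<close> of the two statements.\<close>
  have PJ: "P \<inter> J = {}" and IJ: "I \<inter> J = J"
    by (simp_all add: P_def I_def J_def coord_sets_Int)
  have d: "ds + (d - ds) = d" using assms(3) by simp
  have line: "Cq (l - 1) \<notin> P" by (auto simp: P_def phi_coords_def)
  have J: "finite J" "normal_coords m l ds (d - ds) \<subseteq> J"
    by (simp_all add: J_def finite_coords A.normal_sub)
  note A = A.analytic_family_slice[of ds "d - ds"] A.kronecker_torus_subset_fibres[OF line]
    A.slice_mono[of ds 0] A.analytic_family_slice[of ds 0] A.slice_symmetric[of _ ds]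
    A.origin_mem_slice[of ds 0] A.kronecker_origin_torus A.unique_origin_torus A.slice_full
  note B = B.analytic_family_slice[of ds "d - ds"]
    B.slice_mono[of ds 0] B.analytic_family_slice[of ds 0] B.slice_symmetric[of _ ds]
    B.origin_mem_slice[of ds 0] B.kronecker_origin_torus B.strongly_isolated_origin_torus B.slice_full
  have polA: "polynomial_in I J (\<lambda>x. A.X (cls P x) c)" for c
  proof (cases c)
    case (Cq j)
    then show ?thesis
      by (cases "Suc j = l")
        (simp_all add: A.X_cls A.field_def A.drift_def J polynomial_in_const polynomial_in_sum_squares)
  qed (simp_all add: A.X_cls A.field_def polynomial_in_const)
  have polB: "trig_polynomial_in I J (\<lambda>x. B.X (cls I x) c)" for c
  proof (cases c)
    case (Cq j)
    then show ?thesis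
      by (cases "Suc j = l")
        (simp_all add: B.X_cls B.field_def B.drift_def J trig_polynomial_in_const
          trig_polynomial_in_sum_one_minus_cos)
  qed (simp_all add: B.X_cls B.field_def trig_polynomial_in_const)
  have partA: "vector_field I P A.X \<and> reversible I P A.X GG \<and>
      (\<forall>c\<in>I. polynomial_in I J (\<lambda>x. A.X (cls P x) c))"
    using polA A.vector_field_X A.reversible_X by (simp add: I_def)
  have partB: "vector_field I I B.X \<and> reversible I I B.X GG \<and>
      (\<forall>c\<in>I. trig_polynomial_in I J (\<lambda>x. B.X (cls I x) c))"
    using polB B.vector_field_X B.reversible_X by (simp add: I_def)
  have symB: "\<exists>y\<in>s. \<forall>j<l. y (Cq j) = 0 \<or> y (Cq j) = pi" if "s \<in> B.slice ds 0" for s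
    using B.slice_symmetric[OF that] by blast
  show ?thesis
    apply (intro conjI)
    subgoal unfolding I_def by (rule involution_GG)
    subgoal
      apply (rule exI[of _ A.X], intro conjI)
         apply (use partA in blast)+
      \<comment> \<open>The dimensions are \<open>ds + (d - ds) = d\<close> for the family and
        \<open>ds + 0 = ds\<close> for the subfamily.\<close>
      apply (rule exI[of _ "A.slice ds (d - ds)"], rule exI[of _ "A.slice ds 0"])
      using A line d unfolding I_def[symmetric] J_def[symmetric] PJ by auto
    subgoal unfolding I_def by (rule involution_GG)
    subgoal
      apply (rule exI[of _ B.X], intro conjI)
         apply (use partB in blast)+
      apply (rule exI[of _ "B.slice ds (d - ds)"], rule exI[of _ "B.slice ds 0"])
      using B symB d unfolding I_def[symmetric] J_def[symmetric] IJ by auto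
    done
qed

end
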